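(* Let $g(z)$ be an analytic function on the right half plane $\mathbf H=\{z\in\mathbb C: \Re(z)>\frac12\}$. Then $g\in\mathcal M(\mathcal H^\infty)$ (i.e. there is $f\in\mathcal H^\infty$ with $g(z)=\mathcal M f(z)$ for all $z\in\mathbf H$) if and only if the following three conditions hold: 1. for any $n>0$ and any finite closed interval $I\subset(\frac12,\infty)$ there is a constant $C_{I,n}$ such that $|g(\sigma+is_1)|\le C_{I,n}|\sigma+is_1|^{-n}$ for all $s_1\in\mathbb R$ and $\sigma\in I$; 2. the functions $s_1\mapsto g(\sigma+is_1)$ have a limit in $L^2(\mathbb R)$, denoted $g(\frac12+is_1)$, as $\sigma\to\frac12$ (from the right); 3. for any $n\ge1$, the functions $s_1\mapsto s_1^n g(\sigma+is_1)$ have a limit in $L^2(\mathbb R)$ as $\sigma\to\frac12$ (from the right).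
   Context: $\mathbb R^+=(0,\infty)$. $G$ is the $ax+b$ group, with elements $ab_t$ ($a\in\mathbb R^+$, $t\in\mathbb R$) and product $ab_t\,a'b_{t'}=aa'\,b_{a't+t'}$. $\mu$ is the unitary representation of $G$ on $\mathcal H=L^2(\mathbb R^+)$ (Lebesgue measure) given by $\mu(a)f(x)=a^{-1/2}f(a^{-1}x)$, $\mu(b_t)f(x)=\exp(-2\pi i t x)f(x)$. $\mathcal H^\infty$ is the space of smooth vectors of $\mu$; equivalently, $\mathcal H^\infty=\{f\in C^\infty(\mathbb R^+): x^m\frac{d^nf}{dx^n}\in L^2(\mathbb R^+)\ \forall\, m\ge n\ge0\}$. The Mellin transform is $\mathcal Mf(s)=\int_0^\infty f(x)x^s\frac{dx}{x}$; for $f\in\mathcal H^\infty$ the integral converges absolutely for $\Re s>\frac12$. *)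

theory Defs
  imports "HOL-Analysis.Analysis"
begin

definition L2 :: "'a measure \<Rightarrow> ('a \<Rightarrow> complex) set" where
  "L2 M = {f \<in> borel_measurable M. integrable M (\<lambda>x. (norm (f x))\<^sup>2)}"

definition L2_norm :: "'a measure \<Rightarrow> ('a \<Rightarrow> complex) \<Rightarrow> real" where
  "L2_norm M f = sqrt (LINT x|M. (norm (f x))\<^sup>2)"

text \<open>
  The elements of \<open>L2 M\<close> are functions rather than classes modulo null sets, so
  \<open>L2_norm M\<close> is only a seminorm and a limit \<open>h\<close> is determined up to a null set.
\<close>

definition L2_tendsto ::
    "'a measure \<Rightarrow> ('i \<Rightarrow> 'a \<Rightarrow> complex) \<Rightarrow> ('a \<Rightarrow> complex) \<Rightarrow> 'i filter \<Rightarrow> bool" where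
  "L2_tendsto M F h \<F> \<longleftrightarrow>
     h \<in> L2 M \<and> (\<forall>\<^sub>F i in \<F>. F i \<in> L2 M) \<and>
     ((\<lambda>i. L2_norm M (\<lambda>x. F i x - h x)) \<longlongrightarrow> 0) \<F>"

definition nth_derivative :: "nat \<Rightarrow> (real \<Rightarrow> complex) \<Rightarrow> real \<Rightarrow> complex" where
  "nth_derivative n = (\<lambda>f x. vector_derivative f (at x)) ^^ n"

definition smooth_on_pos :: "(real \<Rightarrow> complex) \<Rightarrow> bool" where
  "smooth_on_pos f \<longleftrightarrow> (\<forall>n. \<forall>x>0. nth_derivative n f differentiable (at x))"

text \<open>
  The space of smooth vectors of the unitary representation of the \<open>ax + b\<close> group on
  \<open>L\<^sup>2(0, \<infinity>)\<close>, in its concrete description by weighted square-integrability of the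
  derivatives. A smooth vector is represented by its smooth representative; the values
  of the function outside \<open>(0, \<infinity>)\<close> are irrelevant.
\<close>

definition smooth_vectors :: "(real \<Rightarrow> complex) set" where
  "smooth_vectors = {f. smooth_on_pos f \<and>
     (\<forall>m n. n \<le> m \<longrightarrow>
        (\<lambda>x. x ^ m *\<^sub>R nth_derivative n f x) \<in> L2 (restrict_space lborel {0<..}))}"

definition Mellin :: "(real \<Rightarrow> complex) \<Rightarrow> complex \<Rightarrow> complex" where
  "Mellin f s = (LBINT x:{0<..}. f x * complex_of_real x powr s / complex_of_real x)"

end

theory Submission
  imports Defs "HOL-Probability.Characteristic_Functions" "HOL-Probability.Sinc_Integral"
    "HOL-Complex_Analysis.Cauchy_Integral_Theorem" "HOL-Real_Asymp.Real_Asymp"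
begin

text \<open>
  The substitution \<open>x = e\<^sup>u\<close> turns everything into Fourier analysis on the real line: with
  \<open>F\<^sub>\<sigma>(u) = e\<^sup>\<sigma>\<^sup>u f(e\<^sup>u)\<close>, the function \<open>s \<mapsto> Mf(\<sigma> + is)\<close> is the Fourier transform of \<open>F\<^sub>\<sigma>\<close>, and
  \<open>x\<^sup>m f \<in> L\<^sup>2(0, \<infinity>)\<close> says that \<open>F\<^sub>\<sigma> \<in> L\<^sup>2(\<real>)\<close> for \<open>\<sigma> = m + 1/2\<close>. The boundary line
  \<open>Re z = 1/2\<close> corresponds to \<open>m = 0\<close>: there \<open>F\<^sub>\<sigma>\<close> need not be integrable, so only
  \<open>L\<^sup>2\<close>-statements survive. The analytic tools are the Fourier inversion formula and the
  Plancherel identity, for a bounded continuous integrable function with integrable Fourier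
  transform.

  Suppose \<open>f\<close> is a smooth vector. The Euler operator \<open>Df = x f'\<close> preserves the space of smooth
  vectors, and integration by parts gives \<open>M(Df)(z) = -z Mf(z)\<close>. Iterating, \<open>z\<^sup>n Mf(z)\<close> is up to
  sign the Mellin transform of \<open>D\<^sup>n f\<close>, which is bounded on closed vertical strips inside the half-plane;
  this is the rapid decay (\<open>Mellin_rapid_decay\<close>). By Plancherel, the \<open>L\<^sup>2\<close>-distance between the restrictions of
  \<open>Mf\<close> to two vertical lines \<open>\<sigma>\<close>, \<open>\<tau>\<close> is that between \<open>F\<^sub>\<sigma>\<close> and \<open>F\<^sub>\<tau>\<close>, up to the factor
  \<open>sqrt (2\<pi>)\<close>. Both of these tend to \<open>F\<^sub>1\<^sub>/\<^sub>2\<close> in \<open>L\<^sup>2\<close> by dominated convergence, so the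
  restrictions are Cauchy and converge by completeness (\<open>Mellin_boundary_limit\<close>). For the weights
  \<open>s\<^sup>n\<close> one writes \<open>s = i(\<sigma> - z)\<close> and trades each factor \<open>z\<close> for an application of \<open>D\<close>
  (\<open>Mellin_boundary_limit_power\<close>).

  Conversely, let \<open>g\<close> satisfy the three conditions, and put
  \<open>f(x) = (1/2\<pi>) \<integral> g(\<sigma> + is) x powr (-\<sigma> - is) ds\<close>. Cauchy's theorem and the decay make this independent of
  \<open>\<sigma> > 1/2\<close> (\<open>vertical_line_integral_shift\<close>). Differentiating under the integral sign shows that
  \<open>x\<^sup>n\<close> times the \<open>n\<close>-th derivative of \<open>f\<close> is the inverse Mellin transform of \<open>(-1)\<^sup>n z(z+1)\<dots>(z+n-1) g(z)\<close>, which satisfies the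
  same three conditions, because they are stable under multiplication by linear polynomials in \<open>z\<close>.
  So it is enough to show that \<open>x\<^sup>k h \<in> L\<^sup>2\<close> for every \<open>k \<ge> 0\<close> when \<open>h\<close> is the inverse Mellin
  transform of a function \<open>G\<close> satisfying the conditions. For \<open>k \<ge> 1\<close> this is Plancherel on the line
  \<open>\<sigma> = k + 1/2\<close>. For \<open>k = 0\<close> it follows from Fatou's lemma as \<open>\<sigma> \<rightarrow> 1/2\<close>, since a family that
  converges in \<open>L\<^sup>2\<close> is bounded in \<open>L\<^sup>2\<close> (\<open>inverse_Mellin_exp_boundary_L2\<close>). Finally Fourier
  inversion on each vertical line gives \<open>Mf = g\<close>.
\<close>

section \<open>Fourier inversion and the Plancherel identity\<close>

definition fourier :: "(real \<Rightarrow> complex) \<Rightarrow> real \<Rightarrow> complex" where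
  "fourier F s = (LINT u|lborel. F u * cis (u * s))"

lemma measurable_cis[measurable (raw)]: "f \<in> borel_measurable M \<Longrightarrow> (\<lambda>x. cis (f x)) \<in> borel_measurable M"
  by (rule borel_measurable_continuous_on[OF continuous_on_cis[OF continuous_on_id]])

lemma integrable_mult_cis:
  assumes "integrable lborel F" "f \<in> borel_measurable borel"
  shows "integrable lborel (\<lambda>u. F u * cis (f u))"
  using assms by (intro Bochner_Integration.integrable_bound[OF assms(1)]) (auto simp: norm_mult)

lemma fourier_measurable[measurable]:
  assumes [measurable]: "F \<in> borel_measurable borel"
  shows "fourier F \<in> borel_measurable borel"
  unfolding fourier_def by measurable

lemma norm_fourier_le: "norm (fourier F s) \<le> (LINT u|lborel. norm (F u))"
  unfolding fourier_def
  by (rule order.trans[OF integral_norm_bound]) (simp add: norm_mult)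

lemma fourier_diff:
  assumes "integrable lborel F" "integrable lborel G"
  shows "fourier (\<lambda>u. F u - G u) s = fourier F s - fourier G s"
  unfolding fourier_def using assms
  by (simp add: left_diff_distrib Bochner_Integration.integral_diff[OF integrable_mult_cis integrable_mult_cis])

lemma fourier_add:
  assumes "integrable lborel F" "integrable lborel G"
  shows "fourier (\<lambda>u. F u + G u) s = fourier F s + fourier G s"
  unfolding fourier_def using assms
  by (simp add: distrib_right Bochner_Integration.integral_add[OF integrable_mult_cis integrable_mult_cis])

lemma fourier_cmult: "fourier (\<lambda>u. c * F u) s = c * fourier F s"
  unfolding fourier_def by (simp add: mult.assoc)

text \<open>
  The integrability needed for the applications of Fubini below: there the kernel \<open>k\<close> is always
  a phase factor.
\<close>

lemma integrable_tensor:
  fixes F G :: "real \<Rightarrow> complex" and k :: "real \<times> real \<Rightarrow> complex"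
  assumes F: "integrable lborel F" and G: "integrable lborel G"
    and k[measurable]: "k \<in> borel_measurable (borel \<Otimes>\<^sub>M borel)" and k1: "\<And>p. norm (k p) \<le> 1"
  shows "integrable (lborel \<Otimes>\<^sub>M lborel) (\<lambda>(x, y). F x * G y * k (x, y))"
proof (rule lborel_pair.Fubini_integrable)
  note [measurable] = borel_measurable_integrable[OF F] borel_measurable_integrable[OF G]
  have int: "integrable lborel (\<lambda>y. F x * G y * k (x, y))" for x
    by (rule Bochner_Integration.integrable_bound[OF integrable_mult_right[OF G, of "F x"]])
       (auto simp: norm_mult intro!: mult_right_le_one_le k1)
  show "(\<lambda>(x, y). F x * G y * k (x, y)) \<in> borel_measurable (lborel \<Otimes>\<^sub>M lborel)"
    by measurable
  show "AE x in lborel. integrable lborel (\<lambda>y. case (x, y) of (x, y) \<Rightarrow> F x * G y * k (x, y))"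
    using int by simp
  show "integrable lborel (\<lambda>x. LINT y|lborel. norm (case (x, y) of (x, y) \<Rightarrow> F x * G y * k (x, y)))"
  proof (rule Bochner_Integration.integrable_bound)
    show "integrable lborel (\<lambda>x. norm (F x) * (LINT y|lborel. norm (G y)))"
      using F by simp
    have "(LINT y|lborel. norm (F x * G y * k (x, y))) \<le> norm (F x) * (LINT y|lborel. norm (G y))" for x
    proof -
      have "(LINT y|lborel. norm (F x * G y * k (x, y))) \<le> (LINT y|lborel. norm (F x) * norm (G y))"
        using G by (intro integral_mono integrable_norm int)
          (auto simp: norm_mult intro!: mult_right_le_one_le k1)
      then show ?thesis by simp
    qed
    then show "AE x in lborel. norm (LINT y|lborel. norm (case (x, y) of (x, y) \<Rightarrow> F x * G y * k (x, y)))
        \<le> norm (norm (F x) * (LINT y|lborel. norm (G y)))"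
      by (auto simp: abs_mult)
  qed measurable
qed

text \<open>
  The characteristic function of the standard normal distribution, rescaled.
\<close>

lemma gaussian_fourier:
  assumes "e > 0"
  shows "integrable lborel (\<lambda>s. complex_of_real (std_normal_density (e * s)))"
    and "(LINT s|lborel. complex_of_real (std_normal_density (e * s)) * cis (s * t))
          = complex_of_real (exp (- ((t / e)\<^sup>2) / 2) / e)"
proof -
  have i: "integrable lborel (\<lambda>s. complex_of_real (std_normal_density s))"
    using integrable_normal_density[of 1 0] by simp
  show "integrable lborel (\<lambda>s. complex_of_real (std_normal_density (e * s)))"
    using lborel_integrable_real_affine[OF i, of e 0] assms by simp
  have "complex_of_real (exp (- ((t / e)\<^sup>2) / 2)) = char std_normal_distribution (t / e)"
    by (simp add: char_std_normal_distribution)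
  also have "\<dots> = (LINT s|lborel. std_normal_density s *\<^sub>R cis (s * (t / e)))"
    unfolding char_def
    by (subst integral_density) (auto simp: cis_conv_exp mult_ac)
  also have "\<dots> = e *\<^sub>R (LINT s|lborel. std_normal_density (e * s) *\<^sub>R cis (s * t))"
    using assms lborel_integral_real_affine[of e "\<lambda>s. std_normal_density s *\<^sub>R cis (s * (t / e))" 0]
    by simp
  finally show "(LINT s|lborel. complex_of_real (std_normal_density (e * s)) * cis (s * t))
          = complex_of_real (exp (- ((t / e)\<^sup>2) / 2) / e)"
    using assms by (simp add: scaleR_conv_of_real field_simps)
qed

text \<open>
  Inserting the convergence factor \<open>exp (-(es)\<^sup>2/2)\<close> into the inversion integral makes Fubini
  applicable, and turns the integral into an average of \<open>F\<close> against a Gaussian of width \<open>e\<close>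
  around \<open>u\<close>.
\<close>

lemma gaussian_average:
  fixes F :: "real \<Rightarrow> complex"
  assumes F: "integrable lborel F" and e: "e > 0"
  shows "(LINT s|lborel. fourier F s * cis (- s * u) * complex_of_real (exp (- (e * s)\<^sup>2 / 2)))
       = 2 * pi * (LINT w|lborel. F (u + e * w) * complex_of_real (std_normal_density w))"
proof -
  let ?g = "\<lambda>s. complex_of_real (std_normal_density (e * s))"
  let ?k = "\<lambda>p::real \<times> real. cis ((snd p - u) * fst p)"
  note [measurable] = borel_measurable_integrable[OF F]
  have ex: "exp (- (e * s)\<^sup>2 / 2) = sqrt (2 * pi) * std_normal_density (e * s)" for s
    by (simp add: std_normal_density_def)
  have fub: "integrable (lborel \<Otimes>\<^sub>M lborel) (\<lambda>(s, v). ?g s * F v * ?k (s, v))"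
    by (rule integrable_tensor[OF gaussian_fourier(1)[OF e] F]) (auto)
  have "(LINT s|lborel. fourier F s * cis (- s * u) * complex_of_real (exp (- (e * s)\<^sup>2 / 2)))
      = sqrt (2 * pi) * (LINT s|lborel. LINT v|lborel. ?g s * F v * ?k (s, v))"
    unfolding ex fourier_def
    by (subst integral_mult_right_zero[symmetric], rule Bochner_Integration.integral_cong)
       (auto simp: algebra_simps cis_mult simp flip: integral_mult_right_zero integral_mult_left_zero
         intro!: Bochner_Integration.integral_cong)
  also have "(LINT s|lborel. LINT v|lborel. ?g s * F v * ?k (s, v))
      = (LINT v|lborel. LINT s|lborel. ?g s * F v * ?k (s, v))"
    using lborel_pair.Fubini_integral[OF fub] by simp
  also have "\<dots> = (LINT v|lborel. F v * complex_of_real (exp (- (((v - u) / e)\<^sup>2) / 2) / e))"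
  proof (rule Bochner_Integration.integral_cong[OF refl])
    fix v
    have "(LINT s|lborel. ?g s * F v * ?k (s, v)) = (LINT s|lborel. F v * (?g s * cis (s * (v - u))))"
      by (simp add: mult_ac)
    then show "(LINT s|lborel. ?g s * F v * ?k (s, v)) = F v * complex_of_real (exp (- (((v - u) / e)\<^sup>2) / 2) / e)"
      using gaussian_fourier(2)[OF e, of "v - u"] by simp
  qed
  also have "\<dots> = (LINT w|lborel. F (u + e * w) * complex_of_real (exp (- (w\<^sup>2) / 2)))"
    using e lborel_integral_real_affine[of e "\<lambda>v. F v * complex_of_real (exp (- (((v - u) / e)\<^sup>2) / 2) / e)" u]
    by (simp add: scaleR_conv_of_real field_simps)
  also have "\<dots> = sqrt (2 * pi) * (LINT w|lborel. F (u + e * w) * complex_of_real (std_normal_density w))"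
    by (subst integral_mult_right_zero[symmetric], rule Bochner_Integration.integral_cong)
       (auto simp: std_normal_density_def)
  finally show ?thesis
    by (simp flip: of_real_mult mult.assoc)
qed

text \<open>
  Let the width of the Gaussian in \<open>gaussian_average\<close> tend to \<open>0\<close>: the left-hand side converges
  because \<open>fourier F\<close> is integrable, and the right-hand side because \<open>F\<close> is bounded and continuous.
\<close>

theorem fourier_inversion:
  fixes F :: "real \<Rightarrow> complex"
  assumes F: "integrable lborel F" and cont: "continuous_on UNIV F"
    and bdd: "\<And>u. norm (F u) \<le> B" and Fh: "integrable lborel (fourier F)"
  shows "(LINT s|lborel. fourier F s * cis (- s * u)) = 2 * pi * F u"
proof -
  define e where "e = (\<lambda>n::nat. inverse (real (Suc n)))"
  have e0: "e n > 0" for n by (simp add: e_def)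
  have elim: "e \<longlonglongrightarrow> 0" unfolding e_def by (rule LIMSEQ_inverse_real_of_nat)
  note [measurable] = borel_measurable_integrable[OF F] borel_measurable_integrable[OF Fh]
  have "(\<lambda>n. LINT s|lborel. fourier F s * cis (- s * u) * complex_of_real (exp (- (e n * s)\<^sup>2 / 2)))
     \<longlonglongrightarrow> (LINT s|lborel. fourier F s * cis (- s * u))"
  proof (rule integral_dominated_convergence[where w = "\<lambda>s. norm (fourier F s)"])
    show "AE s in lborel. (\<lambda>n. fourier F s * cis (- s * u) * complex_of_real (exp (- (e n * s)\<^sup>2 / 2)))
        \<longlonglongrightarrow> fourier F s * cis (- s * u)"
    proof (rule AE_I2)
      fix s
      have "(\<lambda>n. fourier F s * cis (- s * u) * complex_of_real (exp (- (e n * s)\<^sup>2 / 2)))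
        \<longlonglongrightarrow> fourier F s * cis (- s * u) * complex_of_real (exp (- (0 * s)\<^sup>2 / 2))"
        by (intro tendsto_intros elim) auto
      then show "(\<lambda>n. fourier F s * cis (- s * u) * complex_of_real (exp (- (e n * s)\<^sup>2 / 2)))
        \<longlonglongrightarrow> fourier F s * cis (- s * u)" by simp
    qed
    show "AE s in lborel. norm (fourier F s * cis (- s * u) * complex_of_real (exp (- (e n * s)\<^sup>2 / 2)))
        \<le> norm (fourier F s)" for n
      by (rule AE_I2) (auto simp: norm_mult intro!: mult_right_le_one_le)
  qed (use Fh in auto)
  moreover have "(\<lambda>n. LINT s|lborel. fourier F s * cis (- s * u) * complex_of_real (exp (- (e n * s)\<^sup>2 / 2)))
     \<longlonglongrightarrow> 2 * pi * F u"
  proof -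
    have "(\<lambda>n. LINT w|lborel. F (u + e n * w) * complex_of_real (std_normal_density w))
       \<longlonglongrightarrow> (LINT w|lborel. F u * complex_of_real (std_normal_density w))"
    proof (rule integral_dominated_convergence[where w = "\<lambda>w. B * std_normal_density w"])
      show "AE w in lborel. (\<lambda>n. F (u + e n * w) * complex_of_real (std_normal_density w))
         \<longlonglongrightarrow> F u * complex_of_real (std_normal_density w)"
      proof (intro AE_I2 tendsto_intros)
        fix w
        have "(\<lambda>n. u + e n * w) \<longlonglongrightarrow> u + 0 * w" by (intro tendsto_intros elim)
        moreover have "isCont F u" using cont by (simp add: continuous_on_eq_continuous_at)
        ultimately show "(\<lambda>n. F (u + e n * w)) \<longlonglongrightarrow> F u"
          using isCont_tendsto_compose[of u F] by simp
      qed
      show "AE w in lborel. norm (F (u + e n * w) * complex_of_real (std_normal_density w))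
          \<le> B * std_normal_density w" for n
        by (rule AE_I2) (auto simp: norm_mult intro!: mult_right_mono bdd)
    qed (use integrable_normal_density[of 1 0] in auto)
    moreover have "(LINT w|lborel. F u * complex_of_real (std_normal_density w)) = F u"
      using integral_normal_density[of 1 0] by simp
    ultimately show ?thesis
      unfolding gaussian_average[OF F e0] by (intro tendsto_intros) simp
  qed
  ultimately show ?thesis by (rule LIMSEQ_unique)
qed

text \<open>
  Write one of the two factors of \<open>|fourier F|\<^sup>2\<close> as an integral, exchange the integrals, and apply
  the inversion formula to the inner one.
\<close>

theorem plancherel:
  fixes F :: "real \<Rightarrow> complex"
  assumes F: "integrable lborel F" and cont: "continuous_on UNIV F"
    and bdd: "\<And>u. norm (F u) \<le> B" and Fh: "integrable lborel (fourier F)"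
  shows "integrable lborel (\<lambda>u. (norm (F u))\<^sup>2)"
    and "integrable lborel (\<lambda>s. (norm (fourier F s))\<^sup>2)"
    and "(LINT s|lborel. (norm (fourier F s))\<^sup>2) = 2 * pi * (LINT u|lborel. (norm (F u))\<^sup>2)"
proof -
  note [measurable] = borel_measurable_integrable[OF F] borel_measurable_integrable[OF Fh]
  have sq: "integrable lborel (\<lambda>u. (norm (G u))\<^sup>2)"
    if G: "integrable lborel G" and b: "\<And>u. norm (G u) \<le> b" for G :: "real \<Rightarrow> complex" and b
  proof (rule Bochner_Integration.integrable_bound)
    show "integrable lborel (\<lambda>u. b * norm (G u))" using G by simp
    show "(\<lambda>u. (norm (G u))\<^sup>2) \<in> borel_measurable lborel"
      using borel_measurable_integrable[OF G] by measurable
    show "AE u in lborel. norm ((norm (G u))\<^sup>2) \<le> norm (b * norm (G u))"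
    proof (rule AE_I2)
      fix u
      have "0 \<le> b" using b[of u] norm_ge_zero order.trans by blast
      then show "norm ((norm (G u))\<^sup>2) \<le> norm (b * norm (G u))"
        using mult_right_mono[OF b[of u] norm_ge_zero[of "G u"]] by (simp add: power2_eq_square abs_mult)
    qed
  qed
  show i1: "integrable lborel (\<lambda>u. (norm (F u))\<^sup>2)" by (rule sq[OF F bdd])
  show i2: "integrable lborel (\<lambda>s. (norm (fourier F s))\<^sup>2)" by (rule sq[OF Fh norm_fourier_le])
  let ?k = "\<lambda>p::real \<times> real. cis (- (fst p * snd p))"
  have cF: "integrable lborel (\<lambda>v. cnj (F v))" using F by simp
  have fub: "integrable (lborel \<Otimes>\<^sub>M lborel) (\<lambda>(s, v). fourier F s * cnj (F v) * ?k (s, v))"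
    by (rule integrable_tensor[OF Fh cF]) auto
  have "complex_of_real (LINT s|lborel. (norm (fourier F s))\<^sup>2) = (LINT s|lborel. fourier F s * cnj (fourier F s))"
    by (simp add: complex_norm_square[symmetric] del: of_real_power flip: integral_complex_of_real)
  also have "\<dots> = (LINT s|lborel. LINT v|lborel. fourier F s * cnj (F v) * ?k (s, v))"
  proof (rule Bochner_Integration.integral_cong[OF refl])
    fix s
    have "cnj (fourier F s) = (LINT v|lborel. cnj (F v) * ?k (s, v))"
      unfolding fourier_def by (subst Bochner_Integration.integral_cnj[symmetric]) (simp add: cis_cnj mult.commute)
    then show "fourier F s * cnj (fourier F s) = (LINT v|lborel. fourier F s * cnj (F v) * ?k (s, v))"
      by (simp add: mult.assoc)
  qed
  also have "\<dots> = (LINT v|lborel. LINT s|lborel. fourier F s * cnj (F v) * ?k (s, v))"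
    using lborel_pair.Fubini_integral[OF fub] by simp
  also have "\<dots> = (LINT v|lborel. 2 * pi * complex_of_real ((norm (F v))\<^sup>2))"
  proof (rule Bochner_Integration.integral_cong[OF refl])
    fix v
    have "(LINT s|lborel. fourier F s * cnj (F v) * ?k (s, v)) = (LINT s|lborel. cnj (F v) * (fourier F s * cis (- s * v)))"
      by (simp add: mult_ac)
    also have "\<dots> = cnj (F v) * (2 * pi * F v)"
      using fourier_inversion[OF F cont bdd Fh, of v] by simp
    finally show "(LINT s|lborel. fourier F s * cnj (F v) * ?k (s, v)) = 2 * pi * complex_of_real ((norm (F v))\<^sup>2)"
      unfolding complex_norm_square by simp
  qed
  also have "\<dots> = complex_of_real (2 * pi * (LINT u|lborel. (norm (F u))\<^sup>2))"
    by (simp flip: integral_complex_of_real)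
  finally show "(LINT s|lborel. (norm (fourier F s))\<^sup>2) = 2 * pi * (LINT u|lborel. (norm (F u))\<^sup>2)"
    using of_real_eq_iff by blast
qed

section \<open>Derivatives and the Fourier transform\<close>

text \<open>
  Integrate \<open>H (u + 1) - H u = \<integral>\<^sub>0\<^sup>1 H' (u + t) dt\<close> over all \<open>u\<close>. By translation invariance the
  left-hand side gives \<open>0\<close> and, after Fubini, the right-hand side gives the integral of \<open>H'\<close>. In
  this way the limits of \<open>H\<close> at infinity do not have to be discussed.
\<close>

theorem integral_derivative_eq_0:
  fixes H H' :: "real \<Rightarrow> complex"
  assumes deriv: "\<And>u. (H has_vector_derivative H' u) (at u)"
    and H: "integrable lborel H" and H': "integrable lborel H'"
    and cont: "continuous_on UNIV H'"
  shows "(LINT u|lborel. H' u) = 0"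
proof -
  note [measurable] = borel_measurable_integrable[OF H']
  have shift: "integrable lborel (\<lambda>u. H' (u + t))" for t
    using lborel_integrable_real_affine[OF H', of 1 t] by (simp add: add.commute)
  have shift': "(LINT u|lborel. f (u + t)) = (LINT u|lborel. f u)" for t and f :: "real \<Rightarrow> 'b::euclidean_space"
    using lborel_integral_real_affine[of 1 f t] by (simp add: add.commute)
  have FTC: "(LINT t|lborel. indicator {0..1::real} t *\<^sub>R H' (u + t)) = H (1 + u) - H u" for u
  proof -
    have "(LINT t|lborel. indicator {0..1::real} t *\<^sub>R H' (u + t)) = H (u + 1) - H (u + 0)"
    proof (rule integral_FTC_Icc)
      show "((\<lambda>t. H (u + t)) has_vector_derivative H' (u + x)) (at x within {0..1})" for x
      proof -
        have "((\<lambda>t. u + t) has_vector_derivative 0 + 1) (at x within {0..1})"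
          by (intro has_vector_derivative_add has_vector_derivative_const has_vector_derivative_id)
        from vector_diff_chain_within[OF this has_vector_derivative_at_within[OF deriv]]
        show ?thesis by (simp add: o_def)
      qed
      show "continuous_on {0..1} (\<lambda>t. H' (u + t))"
        by (intro continuous_on_compose2[OF cont] continuous_intros) auto
    qed simp
    then show ?thesis by (simp add: add.commute)
  qed
  have "integrable (lborel \<Otimes>\<^sub>M lborel) (\<lambda>(t, u). indicator {0..1::real} t *\<^sub>R H' (u + t))"
  proof (rule lborel_pair.Fubini_integrable)
    have "(LINT u|lborel. norm (indicator {0..1} t *\<^sub>R H' (u + t)))
        = indicator {0..1} t * (LINT u|lborel. norm (H' u))" for t
      using shift'[of "\<lambda>u. norm (H' u)" t] by simp
    note eq = this
    show "integrable lborel (\<lambda>t. LINT u|lborel. norm (case (t, u) of (t, u) \<Rightarrow> indicator {0..1::real} t *\<^sub>R H' (u + t)))"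
      unfolding prod.case eq by simp
    show "AE t in lborel. integrable lborel (\<lambda>u. case (t, u) of (t, u) \<Rightarrow> indicator {0..1::real} t *\<^sub>R H' (u + t))"
      unfolding prod.case by (intro AE_I2 integrable_scaleR_right shift)
  qed measurable
  then have "(LINT u|lborel. LINT t|lborel. indicator {0..1::real} t *\<^sub>R H' (u + t))
      = (LINT t|lborel. LINT u|lborel. indicator {0..1::real} t *\<^sub>R H' (u + t))"
    using lborel_pair.Fubini_integral[of "\<lambda>t u. indicator {0..1::real} t *\<^sub>R H' (u + t)"] by simp
  also have "\<dots> = (LINT t|lborel. indicator {0..1::real} t *\<^sub>R (LINT u|lborel. H' u))"
    using shift'[of H'] by simp
  also have "\<dots> = (LINT u|lborel. H' u)" by simp
  finally have "(LINT u|lborel. H (1 + u) - H u) = (LINT u|lborel. H' u)"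
    unfolding FTC .
  moreover have "(LINT u|lborel. H (1 + u) - H u) = 0"
    using H lborel_integrable_real_affine[OF H, of 1 1] lborel_integral_real_affine[of 1 H 1] by simp
  ultimately show ?thesis by simp
qed

lemma has_vector_derivative_cis_mult:
  "((\<lambda>u. cis (u * s)) has_vector_derivative \<i> * s * cis (u * s)) (at u)"
proof -
  have "((\<lambda>z. exp (\<i> * (z * of_real s))) has_field_derivative exp (\<i> * (of_real u * of_real s)) * (\<i> * (1 * of_real s))) (at (of_real u))"
    by (intro DERIV_fun_exp DERIV_cmult DERIV_cmult_right DERIV_ident)
  from has_vector_derivative_real_field[OF this] show ?thesis
    by (simp add: cis_conv_exp mult_ac)
qed

lemma fourier_derivative:
  fixes F F' :: "real \<Rightarrow> complex"
  assumes deriv: "\<And>u. (F has_vector_derivative F' u) (at u)"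
    and F: "integrable lborel F" and F': "integrable lborel F'"
    and cont: "continuous_on UNIV F'"
  shows "fourier F' s = - (\<i> * s) * fourier F s"
proof -
  have contF: "continuous_on UNIV F"
    using deriv by (meson continuous_at_imp_continuous_on has_vector_derivative_continuous)
  have i: "integrable lborel (\<lambda>u. F' u * cis (u * s))" "integrable lborel (\<lambda>u. \<i> * s * (F u * cis (u * s)))"
    using integrable_mult_cis[OF F', of "\<lambda>u. u * s"] integrable_mult_cis[OF F, of "\<lambda>u. u * s"] by auto
  have "(LINT u|lborel. F' u * cis (u * s) + \<i> * s * (F u * cis (u * s))) = 0"
  proof (rule integral_derivative_eq_0)
    show "((\<lambda>u. F u * cis (u * s)) has_vector_derivative F' u * cis (u * s) + \<i> * s * (F u * cis (u * s))) (at u)" for u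
      using has_vector_derivative_mult[OF deriv has_vector_derivative_cis_mult[of s u]]
      by (simp add: algebra_simps)
    show "integrable lborel (\<lambda>u. F u * cis (u * s))" by (rule integrable_mult_cis[OF F]) auto
    show "continuous_on UNIV (\<lambda>u. F' u * cis (u * s) + \<i> * s * (F u * cis (u * s)))"
      by (intro continuous_intros cont contF)
  qed (use i in auto)
  then show ?thesis
    unfolding fourier_def using i
    by (simp add: add_eq_0_iff)
qed

text \<open>
  This supplies the boundedness required in \<open>fourier_inversion\<close> and \<open>plancherel\<close>.
\<close>

lemma bounded_if_derivative_integrable:
  fixes F F' :: "real \<Rightarrow> complex"
  assumes deriv: "\<And>u. (F has_vector_derivative F' u) (at u)"
    and F': "integrable lborel F'" and cont: "continuous_on UNIV F'"
  shows "norm (F u) \<le> norm (F 0) + (LINT u|lborel. norm (F' u))"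
proof -
  have *: "norm (F b - F a) \<le> (LINT u|lborel. norm (F' u))" if "a \<le> b" for a b
  proof -
    have "has_bochner_integral lborel (\<lambda>x. indicator {a..b} x *\<^sub>R F' x) (F b - F a)"
      by (rule has_bochner_integral_FTC_Icc[OF that])
         (auto intro: has_vector_derivative_at_within deriv continuous_on_subset[OF cont])
    then have i: "integrable lborel (\<lambda>x. indicator {a..b} x *\<^sub>R F' x)"
      and "F b - F a = (LINT x|lborel. indicator {a..b} x *\<^sub>R F' x)"
      by (auto simp: has_bochner_integral_iff)
    then have "norm (F b - F a) \<le> (LINT x|lborel. norm (indicator {a..b} x *\<^sub>R F' x))"
      using integral_norm_bound by metis
    also have "\<dots> \<le> (LINT x|lborel. norm (F' x))"
      by (intro integral_mono integrable_norm i F') (auto split: split_indicator)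
    finally show ?thesis .
  qed
  have "norm (F u - F 0) \<le> (LINT u|lborel. norm (F' u))"
    using *[of 0 u] *[of u 0] by (cases "0 \<le> u") (auto simp: norm_minus_commute)
  then show ?thesis using norm_triangle_sub[of "F u" "F 0"] by linarith
qed

section \<open>The substitution of the exponential function\<close>

lemma set_integrable_Ioi_iff_exp:
  fixes f :: "real \<Rightarrow> 'a::euclidean_space"
  assumes cont: "continuous_on {0<..} f"
  shows "set_integrable lborel {0<..} f \<longleftrightarrow> integrable lborel (\<lambda>u. exp u *\<^sub>R f (exp u))"
proof
  have isC: "isCont f x" if "x > 0" for x
    using cont that by (simp add: continuous_on_eq_continuous_at)
  have lim1: "((ereal \<circ> exp \<circ> real_of_ereal) \<longlongrightarrow> 0) (at_right (- \<infinity>))"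
    using exp_at_bot by (simp add: zero_ereal_def ereal_tendsto_simps)
  have lim2: "((ereal \<circ> exp \<circ> real_of_ereal) \<longlongrightarrow> \<infinity>) (at_left \<infinity>)"
    using exp_at_top by (simp add: ereal_tendsto_simps)
  have cexp: "continuous_on UNIV (\<lambda>u. f (exp u))"
    by (rule continuous_on_compose2[OF cont]) (auto intro: continuous_intros)
  {
    assume i: "integrable lborel (\<lambda>u. exp u *\<^sub>R f (exp u))"
    have "set_integrable lborel (einterval 0 \<infinity>) (\<lambda>x. norm (f x))"
    proof (rule interval_integral_substitution_nonneg(1)[where a = "-\<infinity>" and b = \<infinity> and g = exp and g' = exp])
      show "set_integrable lborel (einterval (- \<infinity>) \<infinity>) (\<lambda>x. norm (f (exp x)) * exp x)"
        using integrable_norm[OF i] by (simp add: set_integrable_def mult.commute)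
      show "isCont (\<lambda>x. norm (f x)) (exp x)" for x :: real
        using isC[of "exp x"] by (intro continuous_intros) auto
    qed (use lim1 lim2 in \<open>auto intro: derivative_eq_intros\<close>)
    then have n: "set_integrable lborel {0<..} (\<lambda>x. norm (f x))"
      by (simp add: zero_ereal_def)
    then show "set_integrable lborel {0<..} f"
      using borel_measurable_continuous_on_indicator[OF _ cont]
      unfolding set_integrable_def
      by (subst integrable_norm_iff[symmetric]) auto
  }
  {
    assume "set_integrable lborel {0<..} f"
    then have n: "set_integrable lborel {0<..} (\<lambda>x. norm (f x))"
      by (rule set_integrable_norm)
    have "set_integrable lborel (einterval (-\<infinity>) \<infinity>) (\<lambda>u. exp u * norm (f (exp u)))"
    proof (rule interval_integral_substitution_nonneg(1)[where a = 0 and b = \<infinity> and g = ln and g' = inverse])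
      show "set_integrable lborel (einterval 0 \<infinity>) (\<lambda>x. exp (ln x) * norm (f (exp (ln x))) * inverse x)"
      proof -
        have "set_integrable lborel {0<..} (\<lambda>x. exp (ln x) * norm (f (exp (ln x))) * inverse x) =
          set_integrable lborel {0<..} (\<lambda>x. norm (f x))"
          by (rule set_integrable_cong) auto
        then show ?thesis using n by (simp add: zero_ereal_def)
      qed
      show "isCont (\<lambda>u. exp u * norm (f (exp u))) (ln x)" for x :: real
        using cexp by (intro continuous_intros) (auto simp: continuous_on_eq_continuous_at)
      show "((ereal \<circ> ln \<circ> real_of_ereal) \<longlongrightarrow> - \<infinity>) (at_right 0)"
        using ln_at_0 by (simp add: zero_ereal_def ereal_tendsto_simps)
      show "((ereal \<circ> ln \<circ> real_of_ereal) \<longlongrightarrow> \<infinity>) (at_left \<infinity>)"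
        using ln_at_top by (simp add: ereal_tendsto_simps)
    qed (auto intro!: derivative_eq_intros continuous_intros simp: divide_inverse)
    then have "integrable lborel (\<lambda>u. norm (exp u *\<^sub>R f (exp u)))"
      by (simp add: set_integrable_def)
    moreover have "(\<lambda>u. exp u *\<^sub>R f (exp u)) \<in> borel_measurable lborel"
    proof -
      have "continuous_on UNIV (\<lambda>u. exp u *\<^sub>R f (exp u))" using cexp by (intro continuous_intros)
      then show ?thesis by (simp add: borel_measurable_continuous_onI)
    qed
    ultimately show "integrable lborel (\<lambda>u. exp u *\<^sub>R f (exp u))"
      using integrable_norm_iff by blast
  }
qed

lemma set_integral_Ioi_eq_exp:
  fixes f :: "real \<Rightarrow> 'a::euclidean_space"
  assumes cont: "continuous_on {0<..} f" and i: "integrable lborel (\<lambda>u. exp u *\<^sub>R f (exp u))"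
  shows "(LINT x:{0<..}|lborel. f x) = (LINT u|lborel. exp u *\<^sub>R f (exp u))"
proof -
  have isC: "isCont f x" if "x > 0" for x
    using cont that by (simp add: continuous_on_eq_continuous_at)
  have "(LBINT x=0..\<infinity>. f x) = (LBINT x=-\<infinity>..\<infinity>. exp x *\<^sub>R f (exp x))"
  proof (rule interval_integral_substitution_integrable)
    show "((ereal \<circ> exp \<circ> real_of_ereal) \<longlongrightarrow> 0) (at_right (- \<infinity>))"
      using exp_at_bot by (simp add: zero_ereal_def ereal_tendsto_simps)
    show "((ereal \<circ> exp \<circ> real_of_ereal) \<longlongrightarrow> \<infinity>) (at_left \<infinity>)"
      using exp_at_top by (simp add: ereal_tendsto_simps)
    show "set_integrable lborel (einterval (- \<infinity>) \<infinity>) (\<lambda>x. exp x *\<^sub>R f (exp x))"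
      using i by (simp add: set_integrable_def)
    show "set_integrable lborel (einterval 0 \<infinity>) f"
      using set_integrable_Ioi_iff_exp[OF cont] i by (simp add: zero_ereal_def)
  qed (use isC in \<open>auto intro: derivative_eq_intros\<close>)
  then show ?thesis
    by (simp add: interval_lebesgue_integral_0_infty) (simp add: interval_lebesgue_integral_def set_lebesgue_integral_def)
qed

section \<open>Convergence in the mean square\<close>

text \<open>
  Squared norms with this weak triangle inequality suffice for all limit arguments, and avoid
  the Minkowski inequality.
\<close>

lemma norm_add_sq_le: "(norm (x + y))\<^sup>2 \<le> 2 * (norm x)\<^sup>2 + 2 * (norm y)\<^sup>2" for x y :: complex
proof -
  have "(norm (x + y))\<^sup>2 \<le> (norm x + norm y)\<^sup>2" by (intro power_mono norm_triangle_ineq) auto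
  also have "\<dots> \<le> 2 * (norm x)\<^sup>2 + 2 * (norm y)\<^sup>2"
    using zero_le_power2[of "norm x - norm y"] by (simp add: power2_sum power2_diff)
  finally show ?thesis .
qed

lemma L2_I:
  assumes "f \<in> borel_measurable M" "integrable M b" "\<And>x. x \<in> space M \<Longrightarrow> (norm (f x))\<^sup>2 \<le> b x"
  shows "f \<in> L2 M"
proof -
  have "integrable M (\<lambda>x. (norm (f x))\<^sup>2)"
  proof (rule Bochner_Integration.integrable_bound[OF assms(2)])
    show "AE x in M. norm ((norm (f x))\<^sup>2) \<le> norm (b x)"
      by (rule AE_I2) (use assms(3) in force)
  qed (use assms(1) in measurable)
  then show ?thesis using assms(1) by (simp add: L2_def)
qed

lemma L2_add: "f \<in> L2 M \<Longrightarrow> g \<in> L2 M \<Longrightarrow> (\<lambda>x. f x + g x) \<in> L2 M"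
  by (rule L2_I[where b = "\<lambda>x. 2 * (norm (f x))\<^sup>2 + 2 * (norm (g x))\<^sup>2"])
     (auto simp: L2_def norm_add_sq_le)

lemma L2_cmult: "f \<in> L2 M \<Longrightarrow> (\<lambda>x. c * f x) \<in> L2 M"
  by (auto simp: L2_def norm_mult power_mult_distrib)

lemma L2_diff: "f \<in> L2 M \<Longrightarrow> g \<in> L2 M \<Longrightarrow> (\<lambda>x. f x - g x) \<in> L2 M"
  using L2_add[of f M "\<lambda>x. (-1) * g x"] L2_cmult[of g M "-1"] by simp

lemma L2_integral_add_le:
  assumes "f \<in> L2 M" "g \<in> L2 M"
  shows "(LINT x|M. (norm (f x + g x))\<^sup>2) \<le> 2 * (LINT x|M. (norm (f x))\<^sup>2) + 2 * (LINT x|M. (norm (g x))\<^sup>2)"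
proof -
  have "(LINT x|M. (norm (f x + g x))\<^sup>2) \<le> (LINT x|M. 2 * (norm (f x))\<^sup>2 + 2 * (norm (g x))\<^sup>2)"
    using assms L2_add[OF assms] by (intro integral_mono) (auto simp: L2_def norm_add_sq_le)
  then show ?thesis using assms by (simp add: L2_def)
qed

lemma L2_tendstoI:
  assumes "h \<in> L2 M" "\<forall>\<^sub>F i in \<F>. F i \<in> L2 M"
    and K: "(K \<longlongrightarrow> 0) \<F>" and le: "\<forall>\<^sub>F i in \<F>. (LINT x|M. (norm (F i x - h x))\<^sup>2) \<le> K i"
  shows "L2_tendsto M F h \<F>"
proof -
  have "((\<lambda>i. LINT x|M. (norm (F i x - h x))\<^sup>2) \<longlongrightarrow> 0) \<F>"
    by (rule tendsto_sandwich[OF _ le tendsto_const K]) (auto intro!: always_eventually integral_nonneg)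
  from tendsto_real_sqrt[OF this] show ?thesis
    using assms by (simp add: L2_tendsto_def L2_norm_def)
qed

lemma L2_tendstoD:
  assumes "L2_tendsto M F h \<F>"
  shows "h \<in> L2 M" "\<forall>\<^sub>F i in \<F>. F i \<in> L2 M" "((\<lambda>i. LINT x|M. (norm (F i x - h x))\<^sup>2) \<longlongrightarrow> 0) \<F>"
proof -
  have "((\<lambda>i. (L2_norm M (\<lambda>x. F i x - h x))\<^sup>2) \<longlongrightarrow> 0\<^sup>2) \<F>"
    using assms by (intro tendsto_intros) (simp add: L2_tendsto_def)
  then show "((\<lambda>i. LINT x|M. (norm (F i x - h x))\<^sup>2) \<longlongrightarrow> 0) \<F>"
    by (simp add: L2_norm_def)
qed (use assms in \<open>auto simp: L2_tendsto_def\<close>)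

lemma L2_tendsto_add:
  assumes F: "L2_tendsto M F h \<F>" and G: "L2_tendsto M G k \<F>"
  shows "L2_tendsto M (\<lambda>i x. F i x + G i x) (\<lambda>x. h x + k x) \<F>"
proof (rule L2_tendstoI)
  note FD = L2_tendstoD[OF F] and GD = L2_tendstoD[OF G]
  show "(\<lambda>x. h x + k x) \<in> L2 M" using FD GD by (intro L2_add)
  show "\<forall>\<^sub>F i in \<F>. (\<lambda>x. F i x + G i x) \<in> L2 M"
    using FD(2) GD(2) by eventually_elim (rule L2_add)
  show "((\<lambda>i. 2 * (LINT x|M. (norm (F i x - h x))\<^sup>2) + 2 * (LINT x|M. (norm (G i x - k x))\<^sup>2)) \<longlongrightarrow> 0) \<F>"
    by (rule tendsto_eq_intros FD(3) GD(3) refl)+ simp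
  show "\<forall>\<^sub>F i in \<F>. (LINT x|M. (norm (F i x + G i x - (h x + k x)))\<^sup>2)
     \<le> 2 * (LINT x|M. (norm (F i x - h x))\<^sup>2) + 2 * (LINT x|M. (norm (G i x - k x))\<^sup>2)"
    using FD(2) GD(2)
  proof eventually_elim
    case (elim i)
    show ?case
      using L2_integral_add_le[OF L2_diff[OF elim(1) FD(1)] L2_diff[OF elim(2) GD(1)]]
      by (simp add: algebra_simps)
  qed
qed

lemma L2_tendsto_cmult:
  assumes F: "L2_tendsto M F h \<F>" and c: "(c \<longlongrightarrow> l) \<F>"
  shows "L2_tendsto M (\<lambda>i x. c i * F i x) (\<lambda>x. l * h x) \<F>"
proof (rule L2_tendstoI)
  note FD = L2_tendstoD[OF F]
  show "(\<lambda>x. l * h x) \<in> L2 M" using FD by (intro L2_cmult)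
  show "\<forall>\<^sub>F i in \<F>. (\<lambda>x. c i * F i x) \<in> L2 M"
    using FD(2) by eventually_elim (rule L2_cmult)
  show "((\<lambda>i. 2 * ((norm (c i))\<^sup>2 * (LINT x|M. (norm (F i x - h x))\<^sup>2))
       + 2 * ((norm (c i - l))\<^sup>2 * (LINT x|M. (norm (h x))\<^sup>2))) \<longlongrightarrow> 0) \<F>"
    by (rule tendsto_eq_intros FD(3) c refl)+ simp
  show "\<forall>\<^sub>F i in \<F>. (LINT x|M. (norm (c i * F i x - l * h x))\<^sup>2)
     \<le> 2 * ((norm (c i))\<^sup>2 * (LINT x|M. (norm (F i x - h x))\<^sup>2))
       + 2 * ((norm (c i - l))\<^sup>2 * (LINT x|M. (norm (h x))\<^sup>2))"
    using FD(2)
  proof eventually_elim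
    case (elim i)
    have eq: "c i * F i x - l * h x = c i * (F i x - h x) + (c i - l) * h x" for x
      by (simp add: algebra_simps)
    show ?case
      using L2_integral_add_le[OF L2_cmult[OF L2_diff[OF elim FD(1)], of "c i"] L2_cmult[OF FD(1), of "c i - l"]]
      by (simp only: eq norm_mult power_mult_distrib integral_mult_right_zero)
  qed
qed

text \<open>
  The Riesz--Fischer theorem. The Cauchy condition is stated with a function \<open>K\<close> of one index
  because this is how it arises from the approach to a common limit. Multiplication by the
  integrable weight \<open>w\<close> makes an \<open>L\<^sup>2\<close>-Cauchy sequence Cauchy in \<open>L\<^sup>1\<close>, whence a subsequence converges
  almost everywhere; Fatou's lemma shows that its pointwise limit is the limit in \<open>L\<^sup>2\<close>. The
  sequence \<open>X\<close> witnesses that the filter can be reached by a sequence.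
\<close>

theorem L2_complete:
  fixes F :: "'i \<Rightarrow> 'a \<Rightarrow> complex" and w :: "'a \<Rightarrow> real"
  assumes w: "integrable M w" "\<And>x. 0 < w x" "\<And>x. w x \<le> 1"
    and X: "filterlim X \<F> sequentially" and ev: "\<forall>\<^sub>F i in \<F>. P i"
    and mem: "\<And>i. P i \<Longrightarrow> F i \<in> L2 M"
    and K: "(K \<longlongrightarrow> 0) \<F>"
    and cauchy: "\<And>i j. P i \<Longrightarrow> P j \<Longrightarrow> (LINT x|M. (norm (F i x - F j x))\<^sup>2) \<le> K i + K j"
  shows "\<exists>h. L2_tendsto M F h \<F>"
proof -
  have "\<forall>\<^sub>F n in sequentially. P (X n)"
    using X ev by (simp add: filterlim_iff)
  then obtain N where N: "\<And>n. n \<ge> N \<Longrightarrow> P (X n)" by (auto simp: eventually_sequentially)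
  define Y where "Y n = X (n + N)" for n
  have PY: "P (Y n)" for n using N by (simp add: Y_def)
  have KY: "(\<lambda>n. K (Y n)) \<longlonglongrightarrow> 0"
    unfolding Y_def using filterlim_compose[OF K X] by (rule LIMSEQ_ignore_initial_segment)
  have K0: "0 \<le> K i" if "P i" for i
    using cauchy[OF that that] by simp
  have memY: "F (Y n) \<in> L2 M" for n by (rule mem[OF PY])
  have [measurable]: "F (Y n) \<in> borel_measurable M" for n using memY by (simp add: L2_def)
  note [measurable] = borel_measurable_integrable[OF w(1)]
  have amgm: "w x * norm z \<le> d * w x + (norm z)\<^sup>2 / d" if "d > 0" for d x and z :: complex
  proof -
    have "0 \<le> (d * w x - norm z)\<^sup>2" by simp
    then have "2 * d * w x * norm z \<le> d\<^sup>2 * (w x)\<^sup>2 + (norm z)\<^sup>2"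
      by (simp add: power2_diff power_mult_distrib algebra_simps)
    moreover have "d\<^sup>2 * (w x)\<^sup>2 \<le> d\<^sup>2 * w x"
      using w(2,3)[of x] by (intro mult_left_mono) (auto simp: power2_eq_square intro: mult_left_le_one_le less_imp_le)
    moreover have "0 \<le> d * w x * norm z" using w(2)[of x] that by simp
    ultimately have "d * (w x * norm z) \<le> d * (d * w x) + (norm z)\<^sup>2"
      by (simp add: power2_eq_square algebra_simps)
    then show ?thesis using that by (simp add: field_simps power2_eq_square)
  qed
  define S where "S n x = w x *\<^sub>R F (Y n) x" for n x
  have iS: "integrable M (\<lambda>x. w x *\<^sub>R f x)" if f: "f \<in> L2 M" for f :: "'a \<Rightarrow> complex"
  proof (rule Bochner_Integration.integrable_bound)
    show "integrable M (\<lambda>x. 1 * w x + (norm (f x))\<^sup>2 / 1)" using w f by (simp add: L2_def)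
    have [measurable]: "f \<in> borel_measurable M" using f by (simp add: L2_def)
    show "(\<lambda>x. w x *\<^sub>R f x) \<in> borel_measurable M" by measurable
    show "AE x in M. norm (w x *\<^sub>R f x) \<le> norm (1 * w x + (norm (f x))\<^sup>2 / 1)"
    proof (rule AE_I2)
      fix x show "norm (w x *\<^sub>R f x) \<le> norm (1 * w x + (norm (f x))\<^sup>2 / 1)"
        using amgm[of 1 x "f x"] w(2)[of x] by simp
    qed
  qed
  have "\<exists>N. \<forall>i\<ge>N. \<forall>j\<ge>N. (LINT x|M. norm (S i x - S j x)) < e" if "e > 0" for e
  proof -
    let ?I = "LINT x|M. w x"
    have I: "?I \<ge> 0" using w(2) by (intro Bochner_Integration.integral_nonneg) (auto intro: less_imp_le)
    \<comment> \<open>The parameter of the weighted arithmetic-geometric mean inequality \<open>amgm\<close>, so small that the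
      weight contributes less than \<open>e / 2\<close>.\<close>
    define d where "d = e / (2 * (?I + 1))"
    have d: "d > 0" using that I by (simp add: d_def)
    have dI: "d * ?I < e / 2"
      unfolding d_def using that I by (simp add: field_simps)
    have "\<forall>\<^sub>F n in sequentially. K (Y n) < d * e / 4"
      using KY d that by (intro order_tendstoD) auto
    then obtain N where N: "\<And>n. n \<ge> N \<Longrightarrow> K (Y n) < d * e / 4" by (auto simp: eventually_sequentially)
    have "(LINT x|M. norm (S i x - S j x)) < e" if ij: "i \<ge> N" "j \<ge> N" for i j
    proof -
      let ?D = "\<lambda>x. F (Y i) x - F (Y j) x"
      have D: "?D \<in> L2 M" by (intro L2_diff memY)
      have SD: "S i x - S j x = w x *\<^sub>R ?D x" for x by (simp add: S_def algebra_simps)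
      have "(LINT x|M. norm (S i x - S j x)) \<le> (LINT x|M. d * w x + (norm (?D x))\<^sup>2 / d)"
        unfolding SD
      proof (rule integral_mono)
        show "integrable M (\<lambda>x. d * w x + (norm (?D x))\<^sup>2 / d)" using D w by (simp add: L2_def)
        show "norm (w x *\<^sub>R ?D x) \<le> d * w x + (norm (?D x))\<^sup>2 / d" for x
          using amgm[OF d, of x "?D x"] w(2)[of x] by simp
      qed (intro integrable_norm iS D)
      also have "\<dots> = d * ?I + (LINT x|M. (norm (?D x))\<^sup>2) / d" using D w by (simp add: L2_def)
      also have "\<dots> \<le> d * ?I + (K (Y i) + K (Y j)) / d"
        using cauchy[OF PY PY, of i j] d by (intro add_left_mono divide_right_mono) auto
      also have "(K (Y i) + K (Y j)) / d < e / 2"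
        using N[OF ij(1)] N[OF ij(2)] d by (simp add: field_simps)
      finally show ?thesis using dI by linarith
    qed
    then show ?thesis by blast
  qed
  then obtain r where r: "strict_mono r" and AEr: "AE x in M. Cauchy (\<lambda>i. S (r i) x)"
    using cauchy_L1_AE_cauchy_subseq[of M S] iS[OF memY] unfolding S_def by blast
  define h where "h x = lim (\<lambda>n. F (Y (r n)) x)" for x
  have hm[measurable]: "h \<in> borel_measurable M"
    unfolding h_def by (rule borel_measurable_lim_metric) simp
  have AEh: "AE x in M. (\<lambda>n. F (Y (r n)) x) \<longlonglongrightarrow> h x"
    using AEr
  proof eventually_elim
    case (elim x)
    then obtain l where "(\<lambda>n. S (r n) x) \<longlonglongrightarrow> l" using Cauchy_convergent convergent_def by blast
    then have "(\<lambda>n. inverse (w x) *\<^sub>R S (r n) x) \<longlonglongrightarrow> inverse (w x) *\<^sub>R l" by (intro tendsto_intros)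
    moreover have "inverse (w x) *\<^sub>R S (r n) x = F (Y (r n)) x" for n
      using w(2)[of x] by (simp add: S_def)
    ultimately show ?case unfolding h_def by (simp add: limI)
  qed
  have KZ: "(\<lambda>n. K (Y (r n))) \<longlonglongrightarrow> 0"
    using LIMSEQ_subseq_LIMSEQ[OF KY r] by (simp add: o_def)
  have main: "(\<lambda>x. F i x - h x) \<in> L2 M \<and> (LINT x|M. (norm (F i x - h x))\<^sup>2) \<le> K i" if Pi: "P i" for i
  proof -
    have [measurable]: "F i \<in> borel_measurable M" using mem[OF Pi] by (simp add: L2_def)
    have "(\<integral>\<^sup>+x. ennreal ((norm (F i x - h x))\<^sup>2) \<partial>M)
        = (\<integral>\<^sup>+x. liminf (\<lambda>n. ennreal ((norm (F i x - F (Y (r n)) x))\<^sup>2)) \<partial>M)"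
    proof (rule nn_integral_cong_AE)
      show "AE x in M. ennreal ((norm (F i x - h x))\<^sup>2) = liminf (\<lambda>n. ennreal ((norm (F i x - F (Y (r n)) x))\<^sup>2))"
        using AEh
      proof eventually_elim
        case (elim x)
        have "(\<lambda>n. ennreal ((norm (F i x - F (Y (r n)) x))\<^sup>2)) \<longlonglongrightarrow> ennreal ((norm (F i x - h x))\<^sup>2)"
          by (intro tendsto_intros elim)
        then show ?case by (rule lim_imp_Liminf[OF trivial_limit_sequentially, symmetric])
      qed
    qed
    also have "\<dots> \<le> liminf (\<lambda>n. \<integral>\<^sup>+x. ennreal ((norm (F i x - F (Y (r n)) x))\<^sup>2) \<partial>M)"
      by (rule nn_integral_liminf) measurable
    also have "\<dots> \<le> liminf (\<lambda>n. ennreal (K i + K (Y (r n))))"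
    proof (rule Liminf_mono, rule always_eventually, rule allI)
      fix n
      have "(\<lambda>x. F i x - F (Y (r n)) x) \<in> L2 M" by (intro L2_diff mem Pi PY)
      then have "(\<integral>\<^sup>+x. ennreal ((norm (F i x - F (Y (r n)) x))\<^sup>2) \<partial>M)
          = ennreal (LINT x|M. (norm (F i x - F (Y (r n)) x))\<^sup>2)"
        by (intro nn_integral_eq_integral) (auto simp: L2_def)
      then show "(\<integral>\<^sup>+x. ennreal ((norm (F i x - F (Y (r n)) x))\<^sup>2) \<partial>M) \<le> ennreal (K i + K (Y (r n)))"
        using cauchy[OF Pi PY] by (simp add: ennreal_leI)
    qed
    also have "\<dots> = ennreal (K i + 0)"
      by (intro lim_imp_Liminf tendsto_intros KZ) simp
    finally have le: "(\<integral>\<^sup>+x. ennreal ((norm (F i x - h x))\<^sup>2) \<partial>M) \<le> ennreal (K i)" by simp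
    have int: "integrable M (\<lambda>x. (norm (F i x - h x))\<^sup>2)"
      by (rule integrableI_bounded) (use le in \<open>auto simp: top.not_eq_extremum[symmetric] top_unique\<close>)
    moreover have "(LINT x|M. (norm (F i x - h x))\<^sup>2) \<le> K i"
      using le nn_integral_eq_integral[OF int] K0[OF Pi] by (simp add: ennreal_le_iff)
    ultimately show ?thesis by (simp add: L2_def)
  qed
  have "h \<in> L2 M"
    using L2_diff[OF mem[OF PY[of 0]] conjunct1[OF main[OF PY[of 0]]]] by simp
  then have "L2_tendsto M F h \<F>"
    by (rule L2_tendstoI[OF _ _ K])
       (use ev in \<open>auto elim!: eventually_mono dest: mem main\<close>)
  then show ?thesis by blast
qed

section \<open>Smooth vectors in the logarithmic variable\<close>

definition log_pullback :: "real \<Rightarrow> (real \<Rightarrow> complex) \<Rightarrow> real \<Rightarrow> complex" where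
  "log_pullback \<sigma> f u = exp (\<sigma> * u) *\<^sub>R f (exp u)"

definition euler :: "(real \<Rightarrow> complex) \<Rightarrow> real \<Rightarrow> complex" where
  "euler f x = x *\<^sub>R vector_derivative f (at x)"

lemma nth_derivative_0 [simp]: "nth_derivative 0 f = f"
  by (simp add: nth_derivative_def)

lemma nth_derivative_Suc: "nth_derivative (Suc n) f = (\<lambda>x. vector_derivative (nth_derivative n f) (at x))"
  by (simp add: nth_derivative_def)

lemma smooth_on_pos_has_derivative:
  assumes "smooth_on_pos f" "x > 0"
  shows "(nth_derivative n f has_vector_derivative nth_derivative (Suc n) f x) (at x)"
  using assms by (simp add: smooth_on_pos_def nth_derivative_Suc vector_derivative_works[symmetric])

text \<open>
  The values of a function and its iterated derivatives outside the positive half-line are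
  arbitrary, so a candidate sequence of derivatives \<open>D\<close> has to be compared with
  \<open>nth_derivative n f\<close> on the open half-line only.
\<close>

lemma smooth_on_posI:
  assumes D0: "\<And>x. x > 0 \<Longrightarrow> f x = D 0 x"
    and D: "\<And>n x. x > 0 \<Longrightarrow> (D n has_vector_derivative D (Suc n) x) (at x)"
  shows "smooth_on_pos f" and "x > 0 \<Longrightarrow> nth_derivative n f x = D n x"
proof -
  have *: "nth_derivative n f x = D n x \<and> (nth_derivative n f has_vector_derivative D (Suc n) x) (at x)"
    if "x > 0" for n x
    using that
  proof (induction n arbitrary: x)
    case 0
    have "(f has_vector_derivative D (Suc 0) x) (at x)"
      by (rule has_vector_derivative_transform_within_open[OF D[OF 0], of "{0<..}"])
         (use 0 D0 in auto)
    then show ?case using 0 D0 by simp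
  next
    case (Suc n)
    have eq: "nth_derivative (Suc n) f y = D (Suc n) y" if "y > 0" for y
      unfolding nth_derivative_Suc using Suc.IH[OF that] vector_derivative_at by blast
    have "(nth_derivative (Suc n) f has_vector_derivative D (Suc (Suc n)) x) (at x)"
      by (rule has_vector_derivative_transform_within_open[OF D[OF Suc.prems], of "{0<..}"])
         (use Suc.prems eq in auto)
    then show ?case using eq Suc.prems by simp
  qed
  show "x > 0 \<Longrightarrow> nth_derivative n f x = D n x" using * by simp
  show "smooth_on_pos f"
    unfolding smooth_on_pos_def using * by (auto intro: differentiableI_vector)
qed

lemma euler_derivatives:
  assumes f: "smooth_on_pos f"
  shows "smooth_on_pos (euler f)"
    and "x > 0 \<Longrightarrow> nth_derivative n (euler f) x = x *\<^sub>R nth_derivative (Suc n) f x + real n *\<^sub>R nth_derivative n f x"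
proof -
  let ?D = "\<lambda>n x. x *\<^sub>R nth_derivative (Suc n) f x + real n *\<^sub>R nth_derivative n f x"
  have 1: "euler f x = ?D 0 x" for x by (simp add: euler_def nth_derivative_Suc)
  have 2: "(?D n has_vector_derivative ?D (Suc n) x) (at x)" if "x > 0" for n x
  proof -
    have "((\<lambda>x. x *\<^sub>R nth_derivative (Suc n) f x + real n *\<^sub>R nth_derivative n f x) has_vector_derivative
       (x *\<^sub>R nth_derivative (Suc (Suc n)) f x + 1 *\<^sub>R nth_derivative (Suc n) f x)
       + real n *\<^sub>R nth_derivative (Suc n) f x) (at x)"
      by (intro has_vector_derivative_add has_vector_derivative_scaleR DERIV_ident
          smooth_on_pos_has_derivative[OF f that]
          bounded_linear.has_vector_derivative[OF bounded_linear_scaleR_right])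
    then show ?thesis by (simp add: algebra_simps)
  qed
  show "smooth_on_pos (euler f)" by (rule smooth_on_posI(1)[OF 1 2])
  show "x > 0 \<Longrightarrow> nth_derivative n (euler f) x = ?D n x" by (rule smooth_on_posI(2)[OF 1 2])
qed

lemma L2_cong: "(\<And>x. x \<in> space M \<Longrightarrow> f x = g x) \<Longrightarrow> f \<in> L2 M \<longleftrightarrow> g \<in> L2 M"
  unfolding L2_def mem_Collect_eq
  by (intro conj_cong measurable_cong Bochner_Integration.integrable_cong) auto

lemma euler_smooth_vectors:
  assumes f: "f \<in> smooth_vectors"
  shows "euler f \<in> smooth_vectors"
proof -
  have sm: "smooth_on_pos f"
    and L: "\<And>m n. n \<le> m \<Longrightarrow> (\<lambda>x. x ^ m *\<^sub>R nth_derivative n f x) \<in> L2 (restrict_space lborel {0<..})"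
    using f by (auto simp: smooth_vectors_def)
  have "(\<lambda>x. x ^ m *\<^sub>R nth_derivative n (euler f) x) \<in> L2 (restrict_space lborel {0<..})" if "n \<le> m" for m n
  proof -
    have "(\<lambda>x. x ^ m *\<^sub>R nth_derivative n (euler f) x) \<in> L2 (restrict_space lborel {0<..}) \<longleftrightarrow>
       (\<lambda>x. x ^ Suc m *\<^sub>R nth_derivative (Suc n) f x + of_nat n * (x ^ m *\<^sub>R nth_derivative n f x)) \<in> L2 (restrict_space lborel {0<..})"
      by (rule L2_cong) (auto simp: space_restrict_space euler_derivatives(2)[OF sm] scaleR_conv_of_real algebra_simps)
    moreover have "(\<lambda>x. x ^ Suc m *\<^sub>R nth_derivative (Suc n) f x + of_nat n * (x ^ m *\<^sub>R nth_derivative n f x)) \<in> L2 (restrict_space lborel {0<..})"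
      using that by (intro L2_add L2_cmult L) auto
    ultimately show ?thesis by simp
  qed
  then show ?thesis using euler_derivatives(1)[OF sm] by (auto simp: smooth_vectors_def)
qed

lemma smooth_on_pos_continuous:
  assumes "smooth_on_pos f" shows "continuous_on {0<..} (nth_derivative n f)"
  by (rule continuous_at_imp_continuous_on)
     (auto intro: has_vector_derivative_continuous smooth_on_pos_has_derivative[OF assms])

lemma continuous_log_pullback:
  assumes "continuous_on {0<..} f"
  shows "continuous_on UNIV (log_pullback \<sigma> f)"
  unfolding log_pullback_def
  by (intro continuous_intros continuous_on_compose2[OF assms]) auto

lemma log_pullback_derivative:
  assumes "smooth_on_pos f"
  shows "(log_pullback \<sigma> f has_vector_derivative \<sigma> *\<^sub>R log_pullback \<sigma> f u + log_pullback \<sigma> (euler f) u) (at u)"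
proof -
  have f: "(f has_vector_derivative vector_derivative f (at (exp u))) (at (exp u))"
    using smooth_on_pos_has_derivative[OF assms, of "exp u" 0] by (simp add: nth_derivative_Suc)
  have "(exp has_vector_derivative exp u) (at u)"
    using DERIV_exp[of u] by (simp add: has_real_derivative_iff_has_vector_derivative)
  from vector_diff_chain_at[OF this f]
  have g: "((\<lambda>u. f (exp u)) has_vector_derivative exp u *\<^sub>R vector_derivative f (at (exp u))) (at u)"
    by (simp add: o_def)
  have "((\<lambda>u. exp (\<sigma> * u)) has_real_derivative \<sigma> * exp (\<sigma> * u)) (at u)"
    by (auto intro!: derivative_eq_intros)
  from has_vector_derivative_scaleR[OF this g] show ?thesis
    unfolding log_pullback_def[abs_def] euler_def by (simp add: algebra_simps)
qed

text \<open>
  The Jacobian of \<open>x = e\<^sup>u\<close> contributes \<open>e\<^sup>u\<close>, the square of \<open>e\<^sup>u\<^sup>/\<^sup>2\<close>: this is the origin of the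
  number \<open>1/2\<close> and of the boundary line \<open>Re z = 1/2\<close>.
\<close>

lemma weighted_L2_iff:
  assumes f: "continuous_on {0<..} f"
  shows "(\<lambda>x. x ^ m *\<^sub>R f x) \<in> L2 (restrict_space lborel {0<..})
     \<longleftrightarrow> integrable lborel (\<lambda>u. (norm (log_pullback (m + 1/2) f u))\<^sup>2)"
proof -
  have c: "continuous_on {0<..} (\<lambda>x. x ^ m *\<^sub>R f x)" by (intro continuous_intros f)
  have "(\<lambda>x. x ^ m *\<^sub>R f x) \<in> borel_measurable (restrict_space borel {0<..})"
    by (rule borel_measurable_continuous_on_restrict[OF c])
  then have m: "(\<lambda>x. x ^ m *\<^sub>R f x) \<in> borel_measurable (restrict_space lborel {0<..})"
    by (simp add: measurable_def space_restrict_space sets_restrict_space)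
  have e: "exp u *\<^sub>R (norm (exp u ^ m *\<^sub>R f (exp u)))\<^sup>2 = (norm (log_pullback (m + 1/2) f u))\<^sup>2" for u
  proof -
    have "exp u * (exp u ^ m)\<^sup>2 = (exp ((m + 1/2) * u))\<^sup>2"
      by (simp add: exp_of_nat_mult[symmetric] power2_eq_square exp_add[symmetric] algebra_simps)
    then show ?thesis by (simp add: log_pullback_def power_mult_distrib algebra_simps)
  qed
  have "(\<lambda>x. x ^ m *\<^sub>R f x) \<in> L2 (restrict_space lborel {0<..}) \<longleftrightarrow>
      set_integrable lborel {0<..} (\<lambda>x. (norm (x ^ m *\<^sub>R f x))\<^sup>2)"
    using m by (simp add: L2_def integrable_restrict_space set_integrable_def)
  also have "\<dots> \<longleftrightarrow> integrable lborel (\<lambda>u. exp u *\<^sub>R (norm (exp u ^ m *\<^sub>R f (exp u)))\<^sup>2)"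
    by (rule set_integrable_Ioi_iff_exp) (intro continuous_intros c f)
  finally show ?thesis unfolding e .
qed

lemma exp_between_le:
  fixes a b \<sigma> u :: real
  assumes "a \<le> \<sigma>" "\<sigma> \<le> b"
  shows "exp (\<sigma> * u) \<le> exp (a * u) + exp (b * u)"
proof (cases "u \<ge> 0")
  case True
  then have "exp (\<sigma> * u) \<le> exp (b * u)" using assms by (simp add: mult_right_mono)
  then show ?thesis by (simp add: add_increasing)
next
  case False
  then have "exp (\<sigma> * u) \<le> exp (a * u)" using assms by (simp add: mult_right_mono_neg)
  then show ?thesis by (simp add: add_increasing2)
qed

lemma integrable_inverse_one_plus_square: "integrable lborel (\<lambda>x::real. inverse (1 + x\<^sup>2))"
  using integrable_inverse_1_plus_square by (simp add: set_integrable_def)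

lemma integrable_exp_neg_abs:
  fixes c :: real
  assumes "c > 0"
  shows "integrable lborel (\<lambda>u. exp (- c * \<bar>u\<bar>))"
proof (rule Bochner_Integration.integrable_bound)
  show "integrable lborel (\<lambda>u. (1 + 2 / c\<^sup>2) * inverse (1 + u\<^sup>2))"
    using integrable_inverse_one_plus_square by simp
  have "exp (- c * \<bar>u\<bar>) \<le> (1 + 2 / c\<^sup>2) * inverse (1 + u\<^sup>2)" for u :: real
  proof -
    have "1 + u\<^sup>2 \<le> (1 + 2 / c\<^sup>2) * (1 + (c * \<bar>u\<bar>)\<^sup>2 / 2)"
      using assms by (simp add: field_simps power_mult_distrib)
    also have "\<dots> \<le> (1 + 2 / c\<^sup>2) * exp (c * \<bar>u\<bar>)"
    proof (rule mult_left_mono)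
      have "0 \<le> c * \<bar>u\<bar>" using assms by simp
      then show "1 + (c * \<bar>u\<bar>)\<^sup>2 / 2 \<le> exp (c * \<bar>u\<bar>)"
        using exp_lower_Taylor_quadratic[of "c * \<bar>u\<bar>"] by linarith
    qed simp
    finally have "(1 + u\<^sup>2) * exp (- c * \<bar>u\<bar>) \<le> 1 + 2 / c\<^sup>2"
      by (simp add: exp_minus field_simps)
    moreover have "0 < 1 + u\<^sup>2" by (simp add: add_pos_nonneg)
    ultimately show ?thesis by (simp add: field_simps)
  qed
  then show "AE u in lborel. norm (exp (- c * \<bar>u\<bar>)) \<le> norm ((1 + 2 / c\<^sup>2) * inverse (1 + u\<^sup>2))"
    by (intro AE_I2) (auto intro: order.trans[OF _ abs_ge_self])
qed measurable

context
  fixes f assumes f: "f \<in> smooth_vectors"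
begin

lemma smooth_vector_smooth: "smooth_on_pos f"
  using f by (simp add: smooth_vectors_def)

lemma smooth_vector_cont: "continuous_on {0<..} f"
  using smooth_on_pos_continuous[OF smooth_vector_smooth, of 0] by simp

lemma smooth_vector_pullback_sq: "integrable lborel (\<lambda>u. (norm (log_pullback (real m + 1/2) f u))\<^sup>2)"
proof -
  have "(\<lambda>x. x ^ m *\<^sub>R nth_derivative 0 f x) \<in> L2 (restrict_space lborel {0<..})"
    using f unfolding smooth_vectors_def by blast
  then show ?thesis using weighted_L2_iff[OF smooth_vector_cont, of m] by simp
qed

text \<open>
  The function is the product of the square-integrable function \<open>log_pullback (1/2) f\<close> and of
  \<open>exp ((\<sigma> - 1/2) u)\<close>, which decays as \<open>u \<rightarrow> -\<infinity>\<close>; for \<open>u \<rightarrow> \<infinity>\<close> the same argument applies with a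
  half-integer \<open>m + 1/2 > \<sigma>\<close> in place of \<open>1/2\<close>.
\<close>

lemma smooth_vector_pullback_integrable:
  assumes "\<sigma> > 1/2"
  shows "integrable lborel (log_pullback \<sigma> f)"
proof -
  \<comment> \<open>The rate \<open>d\<close> is at most the distance of \<open>\<sigma>\<close> to both exponents \<open>1/2\<close> and \<open>m + 1/2\<close>.\<close>
  define m where "m = nat \<lceil>\<sigma>\<rceil>"
  have m: "real m \<ge> \<sigma>" unfolding m_def by linarith
  define d where "d = min (\<sigma> - 1/2) (1/2)"
  have d: "d > 0" "d \<le> \<sigma> - 1/2" "d \<le> real m + 1/2 - \<sigma>" using assms m by (auto simp: d_def)
  let ?b = "\<lambda>u. exp (- (2 * d) * \<bar>u\<bar>) + ((norm (log_pullback (1/2) f u))\<^sup>2 + (norm (log_pullback (m + 1/2) f u))\<^sup>2)"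
  have shift: "norm (log_pullback \<sigma> f u) = exp ((\<sigma> - \<tau>) * u) * norm (log_pullback \<tau> f u)" for u \<tau>
    by (simp add: log_pullback_def exp_add[symmetric] algebra_simps mult_exp_exp)
  have amgm: "e * y \<le> e\<^sup>2 + y\<^sup>2" for e y :: real
  proof -
    have "2 * (e * y) \<le> e\<^sup>2 + y\<^sup>2"
      using zero_le_power2[of "e - y"] by (simp add: power2_diff)
    moreover have "0 \<le> e\<^sup>2 + y\<^sup>2" by simp
    ultimately show ?thesis by linarith
  qed
  have bound: "norm (log_pullback \<sigma> f u) \<le> ?b u" for u
  proof (cases "u \<ge> 0")
    case True
    have "norm (log_pullback \<sigma> f u) = exp ((\<sigma> - (m + 1/2)) * u) * norm (log_pullback (m + 1/2) f u)"
      by (rule shift)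
    also have "\<dots> \<le> exp (- d * u) * norm (log_pullback (m + 1/2) f u)"
    proof (rule mult_right_mono)
      have "(\<sigma> - (m + 1/2)) * u \<le> - d * u" using True d by (intro mult_right_mono) auto
      then show "exp ((\<sigma> - (m + 1/2)) * u) \<le> exp (- d * u)" by simp
    qed simp
    also have "\<dots> \<le> (exp (- d * u))\<^sup>2 + (norm (log_pullback (m + 1/2) f u))\<^sup>2" by (rule amgm)
    also have "(exp (- d * u))\<^sup>2 = exp (- (2 * d) * \<bar>u\<bar>)"
      using True by (simp add: exp_double[symmetric] mult.assoc)
    finally show ?thesis using zero_le_power2[of "norm (log_pullback (1/2) f u)"] by linarith
  next
    case False
    have "norm (log_pullback \<sigma> f u) = exp ((\<sigma> - 1/2) * u) * norm (log_pullback (1/2) f u)"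
      by (rule shift)
    also have "\<dots> \<le> exp (d * u) * norm (log_pullback (1/2) f u)"
      using False d by (intro mult_right_mono) (auto intro: mult_right_mono_neg)
    also have "\<dots> \<le> (exp (d * u))\<^sup>2 + (norm (log_pullback (1/2) f u))\<^sup>2" by (rule amgm)
    also have "(exp (d * u))\<^sup>2 = exp (- (2 * d) * \<bar>u\<bar>)"
      using False by (simp add: exp_double[symmetric] mult.assoc)
    finally show ?thesis using zero_le_power2[of "norm (log_pullback (m + 1/2) f u)"] by linarith
  qed
  show ?thesis
  proof (rule Bochner_Integration.integrable_bound)
    show "integrable lborel ?b"
      using integrable_exp_neg_abs[of "2 * d"] smooth_vector_pullback_sq[of 0] smooth_vector_pullback_sq[of m] d(1)
      by simp
    show "log_pullback \<sigma> f \<in> borel_measurable lborel"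
      using continuous_log_pullback[OF smooth_vector_cont] by (simp add: borel_measurable_continuous_onI)
    show "AE u in lborel. norm (log_pullback \<sigma> f u) \<le> norm (?b u)"
      using order.trans[OF bound abs_ge_self] by simp
  qed
qed

end

section \<open>The Mellin transform of a smooth vector\<close>

lemma Mellin_eq_fourier:
  assumes cont: "continuous_on {0<..} f" and int: "integrable lborel (log_pullback \<sigma> f)"
  shows "Mellin f (Complex \<sigma> s) = fourier (log_pullback \<sigma> f) s"
proof -
  let ?\<phi> = "\<lambda>x. f x * complex_of_real x powr Complex \<sigma> s / complex_of_real x"
  let ?\<psi> = "\<lambda>x. f x * exp (Complex \<sigma> s * complex_of_real (ln x)) / complex_of_real x"
  have \<phi>: "?\<phi> x = ?\<psi> x" if "x > 0" for x
    using that by (simp add: powr_def Ln_of_real)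
  have "continuous_on {0<..} ?\<psi>"
    by (intro continuous_intros cont) auto
  moreover have "continuous_on {0<..} ?\<phi> \<longleftrightarrow> continuous_on {0<..} ?\<psi>"
    by (rule continuous_on_cong[OF refl], rule \<phi>) simp
  ultimately have c: "continuous_on {0<..} ?\<phi>" by blast
  have e: "exp u *\<^sub>R ?\<phi> (exp u) = log_pullback \<sigma> f u * cis (u * s)" for u
  proof -
    have "exp (Complex \<sigma> s * complex_of_real u) = exp (\<sigma> * u) * cis (u * s)"
      by (simp add: exp_eq_polar mult.commute)
    then show ?thesis by (subst \<phi>) (auto simp: log_pullback_def scaleR_conv_of_real)
  qed
  have "Mellin f (Complex \<sigma> s) = (LINT u|lborel. exp u *\<^sub>R ?\<phi> (exp u))"
    unfolding Mellin_def
  proof (rule set_integral_Ioi_eq_exp[OF c])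
    show "integrable lborel (\<lambda>u. exp u *\<^sub>R ?\<phi> (exp u))"
      unfolding e by (rule integrable_mult_cis[OF int]) simp
  qed
  then show ?thesis unfolding e fourier_def .
qed

lemma smooth_vector_Mellin:
  assumes "f \<in> smooth_vectors" "\<sigma> > 1/2"
  shows "Mellin f (Complex \<sigma> s) = fourier (log_pullback \<sigma> f) s"
  using assms by (intro Mellin_eq_fourier smooth_vector_cont smooth_vector_pullback_integrable)

text \<open>
  In the variable \<open>u\<close>, the derivative of \<open>F = log_pullback \<sigma> f\<close> is \<open>\<sigma> F + log_pullback \<sigma> (euler f)\<close>.
  Its Fourier transform is \<open>-is\<close> times that of \<open>F\<close>.
\<close>

lemma Mellin_euler:
  assumes f: "f \<in> smooth_vectors" and \<sigma>: "\<sigma> > 1/2"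
  shows "Mellin (euler f) (Complex \<sigma> s) = - Complex \<sigma> s * Mellin f (Complex \<sigma> s)"
proof -
  note ef = euler_smooth_vectors[OF f]
  note i = smooth_vector_pullback_integrable[OF f \<sigma>] smooth_vector_pullback_integrable[OF ef \<sigma>]
  have "fourier (\<lambda>u. \<sigma> *\<^sub>R log_pullback \<sigma> f u + log_pullback \<sigma> (euler f) u) s = - (\<i> * s) * fourier (log_pullback \<sigma> f) s"
    using i by (intro fourier_derivative log_pullback_derivative smooth_vector_smooth[OF f])
      (auto intro!: continuous_intros continuous_log_pullback smooth_vector_cont f ef)
  moreover have "fourier (\<lambda>u. \<sigma> *\<^sub>R log_pullback \<sigma> f u + log_pullback \<sigma> (euler f) u) s
      = \<sigma> * fourier (log_pullback \<sigma> f) s + fourier (log_pullback \<sigma> (euler f)) s"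
    using i unfolding scaleR_conv_of_real
    by (subst fourier_add) (auto simp: fourier_cmult)
  moreover have "Complex \<sigma> s = \<sigma> + \<i> * s" by (simp add: complex_eq_iff)
  ultimately show ?thesis
    unfolding smooth_vector_Mellin[OF f \<sigma>] smooth_vector_Mellin[OF ef \<sigma>]
    by (simp add: algebra_simps eq_neg_iff_add_eq_0)
qed

text \<open>
  By \<open>Mellin_euler\<close>, each factor \<open>|z|\<close> can be absorbed by passing from \<open>f\<close> to \<open>euler f\<close>, so only the
  boundedness on closed strips has to be shown.
\<close>

lemma Mellin_rapid_decay:
  assumes f: "f \<in> smooth_vectors" and ab: "1/2 < a" "a \<le> b"
  shows "\<exists>C. \<forall>s. \<forall>\<sigma>\<in>{a..b}. norm (Mellin f (Complex \<sigma> s)) * norm (Complex \<sigma> s) ^ n \<le> C"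
  using f
proof (induction n arbitrary: f)
  case (0 f)
  have b: "1/2 < b" using ab by simp
  note i = smooth_vector_pullback_integrable[OF 0 ab(1)] smooth_vector_pullback_integrable[OF 0 b]
  have "norm (Mellin f (Complex \<sigma> s)) \<le> (LINT u|lborel. norm (log_pullback a f u) + norm (log_pullback b f u))"
    if "\<sigma> \<in> {a..b}" for \<sigma> s
  proof -
    have \<sigma>: "\<sigma> > 1/2" using that ab by simp
    have "norm (Mellin f (Complex \<sigma> s)) \<le> (LINT u|lborel. norm (log_pullback \<sigma> f u))"
      unfolding smooth_vector_Mellin[OF 0 \<sigma>] by (rule norm_fourier_le)
    also have "\<dots> \<le> (LINT u|lborel. norm (log_pullback a f u) + norm (log_pullback b f u))"
    proof (rule integral_mono)
      fix u
      have "exp (\<sigma> * u) \<le> exp (a * u) + exp (b * u)"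
        using that by (intro exp_between_le) auto
      from mult_right_mono[OF this norm_ge_zero[of "f (exp u)"]]
      show "norm (log_pullback \<sigma> f u) \<le> norm (log_pullback a f u) + norm (log_pullback b f u)"
        by (simp add: log_pullback_def algebra_simps)
    qed (use i smooth_vector_pullback_integrable[OF 0 \<sigma>] in auto)
    finally show ?thesis .
  qed
  then show ?case by (intro exI[of _ "LINT u|lborel. norm (log_pullback a f u) + norm (log_pullback b f u)"]) simp
next
  case (Suc n f)
  from Suc.IH[OF euler_smooth_vectors[OF Suc.prems]] obtain C where
    C: "\<And>s \<sigma>. \<sigma> \<in> {a..b} \<Longrightarrow> norm (Mellin (euler f) (Complex \<sigma> s)) * norm (Complex \<sigma> s) ^ n \<le> C" by blast
  have "norm (Mellin f (Complex \<sigma> s)) * norm (Complex \<sigma> s) ^ Suc n \<le> C" if "\<sigma> \<in> {a..b}" for s \<sigma>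
    using C[OF that, of s] Mellin_euler[OF Suc.prems, of \<sigma> s] that ab
    by (simp add: norm_mult mult_ac)
  then show ?case by blast
qed

lemma one_plus_square_le_norm:
  assumes "1/2 < \<sigma>" shows "1 + s\<^sup>2 \<le> 4 * (norm (Complex \<sigma> s))\<^sup>2"
proof -
  have "(1/2)\<^sup>2 \<le> \<sigma>\<^sup>2" using assms by (intro power_mono) auto
  then have "1 / 4 \<le> \<sigma>\<^sup>2" by (simp add: power2_eq_square)
  moreover have "(norm (Complex \<sigma> s))\<^sup>2 = \<sigma>\<^sup>2 + s\<^sup>2" by (simp add: cmod_power2)
  ultimately show ?thesis using zero_le_power2[of s] by linarith
qed

lemma integrable_if_inverse_square_decay:
  fixes F :: "real \<Rightarrow> complex"
  assumes "F \<in> borel_measurable borel" "\<And>s. norm (F s) \<le> C * inverse (1 + s\<^sup>2)"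
  shows "integrable lborel F"
proof (rule Bochner_Integration.integrable_bound)
  show "integrable lborel (\<lambda>s. C * inverse (1 + s\<^sup>2))"
    using integrable_inverse_one_plus_square by simp
  show "AE s in lborel. norm (F s) \<le> norm (C * inverse (1 + s\<^sup>2))"
    using order.trans[OF assms(2) abs_ge_self] by simp
qed (use assms in simp)

lemma integrable_fourier_pullback:
  assumes f: "f \<in> smooth_vectors" and \<sigma>: "\<sigma> > 1/2"
  shows "integrable lborel (fourier (log_pullback \<sigma> f))"
proof -
  obtain C where C: "\<And>s. norm (Mellin f (Complex \<sigma> s)) * norm (Complex \<sigma> s) ^ 2 \<le> C"
    using Mellin_rapid_decay[OF f \<sigma> order.refl, of 2] by auto
  show ?thesis
  proof (rule integrable_if_inverse_square_decay)
    show "fourier (log_pullback \<sigma> f) \<in> borel_measurable borel"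
      using borel_measurable_integrable[OF smooth_vector_pullback_integrable[OF f \<sigma>]] by simp
    fix s
    have "norm (fourier (log_pullback \<sigma> f) s) * (1 + s\<^sup>2)
       \<le> norm (fourier (log_pullback \<sigma> f) s) * (4 * (norm (Complex \<sigma> s))\<^sup>2)"
      by (intro mult_left_mono one_plus_square_le_norm \<sigma>) auto
    also have "\<dots> \<le> 4 * C" using C[of s] smooth_vector_Mellin[OF f \<sigma>] by simp
    finally show "norm (fourier (log_pullback \<sigma> f) s) \<le> (4 * C) * inverse (1 + s\<^sup>2)"
      by (simp add: field_simps add_pos_nonneg)
  qed
qed

lemma log_pullback_bounded:
  assumes f: "f \<in> smooth_vectors" and \<sigma>: "\<sigma> > 1/2"
  shows "\<exists>B. \<forall>u. norm (log_pullback \<sigma> f u) \<le> B"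
proof -
  note ef = euler_smooth_vectors[OF f]
  have "norm (log_pullback \<sigma> f u) \<le> norm (log_pullback \<sigma> f 0)
      + (LINT u|lborel. norm (\<sigma> *\<^sub>R log_pullback \<sigma> f u + log_pullback \<sigma> (euler f) u))" for u
    using smooth_vector_pullback_integrable[OF f \<sigma>] smooth_vector_pullback_integrable[OF ef \<sigma>]
    by (intro bounded_if_derivative_integrable log_pullback_derivative smooth_vector_smooth[OF f])
      (auto intro!: continuous_intros continuous_log_pullback smooth_vector_cont f ef)
  then show ?thesis by blast
qed

text \<open>
  For \<open>\<sigma>\<close> between \<open>1/2\<close> and \<open>3/2\<close>, \<open>log_pullback \<sigma> f\<close> is dominated by the sum of the absolute values
  at the two end points, and both of these are square-integrable.
\<close>

lemma log_pullback_tendsto_half: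
  assumes f: "f \<in> smooth_vectors"
  shows "((\<lambda>\<sigma>. LINT u|lborel. (norm (log_pullback \<sigma> f u - log_pullback (1/2) f u))\<^sup>2) \<longlongrightarrow> 0) (at_right (1/2))"
proof (rule tendsto_at_right_sequentially[of _ "3/2"])
  fix S :: "nat \<Rightarrow> real" assume S: "\<And>n. 1/2 < S n" "\<And>n. S n < 3/2" "S \<longlonglongrightarrow> 1/2"
  let ?W = "\<lambda>\<sigma>. log_pullback \<sigma> f"
  have [measurable]: "?W \<sigma> \<in> borel_measurable borel" for \<sigma>
    using continuous_log_pullback[OF smooth_vector_cont[OF f]] by (simp add: borel_measurable_continuous_onI)
  have "(\<lambda>n. LINT u|lborel. (norm (?W (S n) u - ?W (1/2) u))\<^sup>2) \<longlonglongrightarrow> (LINT u|(lborel :: real measure). 0::real)"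
  proof (rule integral_dominated_convergence[where
        w = "\<lambda>u. 8 * (norm (log_pullback (1/2) f u))\<^sup>2 + 2 * (norm (log_pullback (3/2) f u))\<^sup>2"])
    show "integrable lborel (\<lambda>u. 8 * (norm (?W (1/2) u))\<^sup>2 + 2 * (norm (?W (3/2) u))\<^sup>2)"
      using smooth_vector_pullback_sq[OF f, of 0] smooth_vector_pullback_sq[OF f, of 1] by simp
    show "AE u in lborel. (\<lambda>n. (norm (?W (S n) u - ?W (1/2) u))\<^sup>2) \<longlonglongrightarrow> 0"
    proof (rule AE_I2)
      fix u
      have "(\<lambda>n. (norm (?W (S n) u - ?W (1/2) u))\<^sup>2) \<longlonglongrightarrow> (norm (?W (1/2) u - ?W (1/2) u))\<^sup>2"
        unfolding log_pullback_def by (intro tendsto_intros S)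
      then show "(\<lambda>n. (norm (?W (S n) u - ?W (1/2) u))\<^sup>2) \<longlonglongrightarrow> 0" by simp
    qed
    show "AE u in lborel. norm ((norm (?W (S n) u - ?W (1/2) u))\<^sup>2) \<le> 8 * (norm (?W (1/2) u))\<^sup>2 + 2 * (norm (?W (3/2) u))\<^sup>2" for n
    proof (rule AE_I2)
      fix u
      have "exp (S n * u) \<le> exp (1/2 * u) + exp (3/2 * u)"
        using S(1,2)[of n] by (intro exp_between_le) auto
      from mult_right_mono[OF this norm_ge_zero[of "f (exp u)"]]
      have "norm (?W (S n) u) \<le> norm (?W (1/2) u) + norm (?W (3/2) u)"
        by (simp add: log_pullback_def algebra_simps)
      then have "norm (?W (S n) u - ?W (1/2) u) \<le> 2 * norm (?W (1/2) u) + norm (?W (3/2) u)"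
        using norm_triangle_ineq4[of "?W (S n) u" "?W (1/2) u"] by linarith
      then have "(norm (?W (S n) u - ?W (1/2) u))\<^sup>2 \<le> (2 * norm (?W (1/2) u) + norm (?W (3/2) u))\<^sup>2"
        by (intro power_mono) auto
      also have "\<dots> \<le> 8 * (norm (?W (1/2) u))\<^sup>2 + 2 * (norm (?W (3/2) u))\<^sup>2"
        using zero_le_power2[of "2 * norm (?W (1/2) u) - norm (?W (3/2) u)"]
        by (simp add: power2_sum power2_diff power_mult_distrib)
      finally show "norm ((norm (?W (S n) u - ?W (1/2) u))\<^sup>2) \<le> 8 * (norm (?W (1/2) u))\<^sup>2 + 2 * (norm (?W (3/2) u))\<^sup>2"
        by simp
    qed
  qed measurable
  then show "(\<lambda>n. LINT u|lborel. (norm (?W (S n) u - ?W (1/2) u))\<^sup>2) \<longlonglongrightarrow> 0" by simp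
qed simp

lemma at_right_sequence:
  fixes a :: real
  shows "(\<lambda>n. a + inverse (real (Suc n))) \<longlonglongrightarrow> a"
    and "filterlim (\<lambda>n. a + inverse (real (Suc n))) (at_right a) sequentially"
proof -
  have "(\<lambda>n. a + inverse (real (Suc n))) \<longlonglongrightarrow> a + 0"
    by (intro tendsto_intros LIMSEQ_inverse_real_of_nat)
  then show "(\<lambda>n. a + inverse (real (Suc n))) \<longlonglongrightarrow> a" by simp
  then show "filterlim (\<lambda>n. a + inverse (real (Suc n))) (at_right a) sequentially"
    by (intro tendsto_imp_filterlim_at_right) auto
qed

text \<open>
  By Plancherel, the distance between the lines \<open>\<sigma>\<close> and \<open>\<tau>\<close> is controlled by the distances of
  \<open>log_pullback \<sigma> f\<close> and \<open>log_pullback \<tau> f\<close> to \<open>log_pullback (1/2) f\<close>. The latter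
  function need not be integrable, so its Fourier transform need not exist as an integral, and the
  limit is obtained from completeness instead.
\<close>

theorem Mellin_boundary_limit:
  assumes f: "f \<in> smooth_vectors"
  shows "\<exists>h. L2_tendsto lborel (\<lambda>\<sigma> s. Mellin f (Complex \<sigma> s)) h (at_right (1/2))"
proof (rule L2_complete[where w = "\<lambda>x. inverse (1 + x\<^sup>2)" and X = "\<lambda>n. 1/2 + inverse (real (Suc n))"
      and P = "\<lambda>\<sigma>. 1/2 < \<sigma>"
      and K = "\<lambda>\<sigma>. 4 * pi * (LINT u|lborel. (norm (log_pullback \<sigma> f u - log_pullback (1/2) f u))\<^sup>2)"])
  let ?W = "\<lambda>\<sigma>. log_pullback \<sigma> f"
  have c: "continuous_on UNIV (?W \<sigma>)" for \<sigma>
    by (rule continuous_log_pullback[OF smooth_vector_cont[OF f]])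
  show "filterlim (\<lambda>n. 1/2 + inverse (real (Suc n))) (at_right (1/2)) sequentially"
    by (rule at_right_sequence)
  show "((\<lambda>\<sigma>. 4 * pi * (LINT u|lborel. (norm (?W \<sigma> u - ?W (1/2) u))\<^sup>2)) \<longlongrightarrow> 0) (at_right (1/2))"
    using tendsto_mult_right_zero[OF log_pullback_tendsto_half[OF f]] .
  fix \<sigma> :: real assume \<sigma>: "1/2 < \<sigma>"
  note i = smooth_vector_pullback_integrable[OF f \<sigma>] integrable_fourier_pullback[OF f \<sigma>]
  obtain B where B: "\<And>u. norm (?W \<sigma> u) \<le> B" using log_pullback_bounded[OF f \<sigma>] by blast
  show "(\<lambda>s. Mellin f (Complex \<sigma> s)) \<in> L2 lborel"
    using plancherel(2)[OF i(1) c B i(2)] borel_measurable_integrable[OF i(2)] smooth_vector_Mellin[OF f \<sigma>]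
    by (simp add: L2_def)
  fix \<tau> :: real assume \<tau>: "1/2 < \<tau>"
  note j = smooth_vector_pullback_integrable[OF f \<tau>] integrable_fourier_pullback[OF f \<tau>]
  obtain B' where B': "\<And>u. norm (?W \<tau> u) \<le> B'" using log_pullback_bounded[OF f \<tau>] by blast
  have L: "(\<lambda>u. ?W \<rho> u - ?W (1/2) u) \<in> L2 lborel" if \<rho>: "1/2 < \<rho>" for \<rho>
  proof -
    note i = smooth_vector_pullback_integrable[OF f \<rho>] integrable_fourier_pullback[OF f \<rho>]
    obtain B where B: "\<And>u. norm (?W \<rho> u) \<le> B" using log_pullback_bounded[OF f \<rho>] by blast
    have m: "?W \<sigma> \<in> borel_measurable borel" for \<sigma> using c by (simp add: borel_measurable_continuous_onI)
    have "?W \<rho> \<in> L2 lborel" using plancherel(1)[OF i(1) c B i(2)] m by (simp add: L2_def)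
    moreover have "?W (1/2) \<in> L2 lborel" using smooth_vector_pullback_sq[OF f, of 0] m by (simp add: L2_def)
    ultimately show ?thesis by (rule L2_diff)
  qed
  have eq: "(LINT s|lborel. (norm (fourier (\<lambda>u. ?W \<sigma> u - ?W \<tau> u) s))\<^sup>2) = 2 * pi * (LINT u|lborel. (norm (?W \<sigma> u - ?W \<tau> u))\<^sup>2)"
  proof (rule plancherel(3))
    show "norm (?W \<sigma> u - ?W \<tau> u) \<le> B + B'" for u
      using B[of u] B'[of u] norm_triangle_ineq4[of "?W \<sigma> u" "?W \<tau> u"] by linarith
    show "integrable lborel (fourier (\<lambda>u. ?W \<sigma> u - ?W \<tau> u))"
      using Bochner_Integration.integrable_diff[OF i(2) j(2)] fourier_diff[OF i(1) j(1)] by presburger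
  qed (use i j c in \<open>auto intro!: continuous_intros\<close>)
  have le: "(LINT u|lborel. (norm (?W \<sigma> u - ?W \<tau> u))\<^sup>2)
      \<le> 2 * (LINT u|lborel. (norm (?W \<sigma> u - ?W (1/2) u))\<^sup>2) + 2 * (LINT u|lborel. (norm (?W \<tau> u - ?W (1/2) u))\<^sup>2)"
    using L2_integral_add_le[OF L[OF \<sigma>] L2_cmult[OF L[OF \<tau>], of "-1"]] by (simp add: norm_minus_commute)
  have diff: "Mellin f (Complex \<sigma> s) - Mellin f (Complex \<tau> s) = fourier (\<lambda>u. ?W \<sigma> u - ?W \<tau> u) s" for s
    using fourier_diff[OF i(1) j(1)] smooth_vector_Mellin[OF f \<sigma>] smooth_vector_Mellin[OF f \<tau>] by simp
  show "(LINT s|lborel. (norm (Mellin f (Complex \<sigma> s) - Mellin f (Complex \<tau> s)))\<^sup>2)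
     \<le> 4 * pi * (LINT u|lborel. (norm (?W \<sigma> u - ?W (1/2) u))\<^sup>2) + 4 * pi * (LINT u|lborel. (norm (?W \<tau> u - ?W (1/2) u))\<^sup>2)"
    unfolding diff eq using mult_left_mono[OF le, of "2 * pi"] by (simp add: distrib_left)
next
  fix x :: real
  show "0 < inverse (1 + x\<^sup>2)" by (intro positive_imp_inverse_positive add_pos_nonneg) auto
  show "inverse (1 + x\<^sup>2) \<le> 1" using le_imp_inverse_le[of 1 "1 + x\<^sup>2"] by simp
qed (rule integrable_inverse_one_plus_square eventually_at_right_less)+

lemma L2_tendsto_cong:
  assumes "\<forall>\<^sub>F i in \<F>. F i = G i"
  shows "L2_tendsto M F h \<F> \<longleftrightarrow> L2_tendsto M G h \<F>"
proof -
  have "(\<forall>\<^sub>F i in \<F>. F i \<in> L2 M) \<longleftrightarrow> (\<forall>\<^sub>F i in \<F>. G i \<in> L2 M)"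
    by (rule eventually_subst) (use assms in eventually_elim, simp)
  moreover have "((\<lambda>i. L2_norm M (\<lambda>x. F i x - h x)) \<longlongrightarrow> 0) \<F> \<longleftrightarrow> ((\<lambda>i. L2_norm M (\<lambda>x. G i x - h x)) \<longlongrightarrow> 0) \<F>"
    by (rule filterlim_cong[OF refl refl]) (use assms in eventually_elim, simp)
  ultimately show ?thesis by (simp add: L2_tendsto_def)
qed

text \<open>
  From \<open>s = i(\<sigma> - z)\<close> and \<open>Mellin_euler\<close> one gets
  \<open>s Mf(z) = i M(euler f)(z) + i \<sigma> Mf(z)\<close> for \<open>z = \<sigma> + is\<close>.
\<close>

theorem Mellin_boundary_limit_power:
  assumes "f \<in> smooth_vectors"
  shows "\<exists>h. L2_tendsto lborel (\<lambda>\<sigma> s. complex_of_real s ^ n * Mellin f (Complex \<sigma> s)) h (at_right (1/2))"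
  using assms
proof (induction n arbitrary: f)
  case 0
  then show ?case using Mellin_boundary_limit by simp
next
  case (Suc n f)
  obtain h k where
    h: "L2_tendsto lborel (\<lambda>\<sigma> s. complex_of_real s ^ n * Mellin (euler f) (Complex \<sigma> s)) h (at_right (1/2))"
    and k: "L2_tendsto lborel (\<lambda>\<sigma> s. complex_of_real s ^ n * Mellin f (Complex \<sigma> s)) k (at_right (1/2))"
    using Suc.IH[OF Suc.prems] Suc.IH[OF euler_smooth_vectors[OF Suc.prems]] by blast
  have "((\<lambda>\<sigma>. \<i> * complex_of_real \<sigma>) \<longlongrightarrow> \<i> * complex_of_real (1/2)) (at_right (1/2))"
    by (intro tendsto_intros)
  note lim = L2_tendsto_add[OF L2_tendsto_cmult[OF h tendsto_const[of \<i>]] L2_tendsto_cmult[OF k this]]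
  have "\<forall>\<^sub>F \<sigma> in at_right (1/2). (\<lambda>s. complex_of_real s ^ Suc n * Mellin f (Complex \<sigma> s))
     = (\<lambda>s. \<i> * (complex_of_real s ^ n * Mellin (euler f) (Complex \<sigma> s))
          + \<i> * complex_of_real \<sigma> * (complex_of_real s ^ n * Mellin f (Complex \<sigma> s)))"
    using eventually_at_right_less[of "1/2 :: real"]
  proof eventually_elim
    case (elim \<sigma>)
    have "complex_of_real s = \<i> * (- Complex \<sigma> s) + \<i> * complex_of_real \<sigma>" for s
      by (simp add: complex_eq_iff)
    then have E: "complex_of_real s * m = \<i> * (- Complex \<sigma> s * m) + \<i> * complex_of_real \<sigma> * m" for s m
      by (metis distrib_right mult.assoc)
    show ?case
    proof
      fix s
      let ?m = "Mellin f (Complex \<sigma> s)"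
      have "complex_of_real s ^ Suc n * ?m = complex_of_real s ^ n * (complex_of_real s * ?m)" by simp
      also have "\<dots> = \<i> * (complex_of_real s ^ n * (- Complex \<sigma> s * ?m)) + \<i> * complex_of_real \<sigma> * (complex_of_real s ^ n * ?m)"
        unfolding E by (simp only: distrib_left mult_ac)
      finally show "complex_of_real s ^ Suc n * ?m = \<i> * (complex_of_real s ^ n * Mellin (euler f) (Complex \<sigma> s))
          + \<i> * complex_of_real \<sigma> * (complex_of_real s ^ n * ?m)"
        unfolding Mellin_euler[OF Suc.prems elim] .
    qed
  qed
  note L2_tendsto_cong[OF this, THEN iffD2, OF lim]
  then show ?case by blast
qed

section \<open>Inverting the Mellin transform\<close>

text \<open>
  The difference quotients converge under the integral sign, since \<open>|e\<^sup>i\<^sup>t - 1| \<le> |t|\<close> bounds their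
  remainders by \<open>2 |u F(u)|\<close>.
\<close>

lemma fourier_has_vector_derivative:
  assumes F: "integrable lborel F" and uF: "integrable lborel (\<lambda>u. complex_of_real u * F u)"
  shows "(fourier F has_vector_derivative fourier (\<lambda>u. \<i> * (complex_of_real u * F u)) s) (at s)"
  unfolding has_vector_derivative_def has_derivative_at
proof
  show "bounded_linear (\<lambda>x. x *\<^sub>R fourier (\<lambda>u. \<i> * (complex_of_real u * F u)) s)"
    by (rule bounded_linear_scaleR_left)
  note [measurable] = borel_measurable_integrable[OF F]
  let ?q = "\<lambda>h u. cis (u * (s + h)) - cis (u * s) - h *\<^sub>R (\<i> * u * cis (u * s))"
  have eq: "fourier F (s + h) - fourier F s - h *\<^sub>R fourier (\<lambda>u. \<i> * (complex_of_real u * F u)) s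
      = (LINT u|lborel. F u * ?q h u)" for h
  proof -
    have i1: "integrable lborel (\<lambda>u. F u * cis (u * (s + h)))" "integrable lborel (\<lambda>u. F u * cis (u * s))"
      by (rule integrable_mult_cis[OF F]; simp)+
    have i2: "integrable lborel (\<lambda>u. complex_of_real u * F u * cis (u * s))"
      by (rule integrable_mult_cis[OF uF]) simp
    have "(LINT u|lborel. F u * ?q h u)
       = (LINT u|lborel. F u * cis (u * (s + h)) - F u * cis (u * s) - (h * \<i>) * (complex_of_real u * F u * cis (u * s)))"
      by (rule Bochner_Integration.integral_cong[OF refl]) (simp add: scaleR_conv_of_real right_diff_distrib mult_ac)
    also have "\<dots> = fourier F (s + h) - fourier F s - (h * \<i>) * (LINT u|lborel. complex_of_real u * F u * cis (u * s))"
      using i1 i2 by (simp add: fourier_def)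
    finally show ?thesis
      unfolding fourier_cmult by (simp add: fourier_def scaleR_conv_of_real mult.assoc)
  qed
  show "(\<lambda>h. norm (fourier F (s + h) - fourier F s - h *\<^sub>R fourier (\<lambda>u. \<i> * (complex_of_real u * F u)) s) / norm h) \<midarrow>0\<rightarrow> 0"
    unfolding eq tendsto_at_iff_sequentially
  proof (intro allI impI)
    fix X :: "nat \<Rightarrow> real" assume X: "\<forall>i. X i \<in> UNIV - {0}" "X \<longlonglongrightarrow> 0"
    have X0: "X n \<noteq> 0" for n using X(1) by blast
    have "(\<lambda>n. LINT u|lborel. F u * ?q (X n) u / X n) \<longlonglongrightarrow> (LINT u|(lborel::real measure). 0::complex)"
    proof (rule integral_dominated_convergence[where w = "\<lambda>u. 2 * norm (complex_of_real u * F u)"])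
      show "AE u in lborel. (\<lambda>n. F u * ?q (X n) u / X n) \<longlonglongrightarrow> 0"
      proof (rule AE_I2)
        fix u
        have "((\<lambda>s. cis (u * s)) has_vector_derivative \<i> * u * cis (u * s)) (at s)"
          using has_vector_derivative_cis_mult[of u s] by (simp add: mult.commute)
        then have "(\<lambda>h. norm (?q h u) / norm h) \<midarrow>0\<rightarrow> 0"
          unfolding has_vector_derivative_def has_derivative_at by blast
        then have "(\<lambda>n. norm (?q (X n) u) / norm (X n)) \<longlonglongrightarrow> 0"
          using X unfolding tendsto_at_iff_sequentially by (simp add: o_def)
        then have "(\<lambda>n. norm (F u) * (norm (?q (X n) u) / norm (X n))) \<longlonglongrightarrow> 0"
          by (rule tendsto_mult_right_zero)
        then have "(\<lambda>n. norm (F u * ?q (X n) u / X n)) \<longlonglongrightarrow> 0"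
          by (simp add: norm_mult norm_divide del: scaleR_conv_of_real)
        then show "(\<lambda>n. F u * ?q (X n) u / X n) \<longlonglongrightarrow> 0"
          by (rule tendsto_norm_zero_cancel)
      qed
      show "AE u in lborel. norm (F u * ?q (X n) u / X n) \<le> 2 * norm (complex_of_real u * F u)" for n
      proof (rule AE_I2)
        fix u
        have "?q (X n) u = cis (u * s) * (cis (u * X n) - 1 - \<i> * (u * X n))"
          by (simp add: algebra_simps cis_mult scaleR_conv_of_real)
        then have "norm (?q (X n) u) = norm (cis (u * X n) - 1 - \<i> * (u * X n))"
          by (simp add: norm_mult)
        also have "\<dots> \<le> norm (cis (u * X n) - 1) + norm (\<i> * (u * X n))"
          by (rule norm_triangle_ineq4)
        also have "\<dots> \<le> \<bar>u * X n\<bar> + \<bar>u * X n\<bar>"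
          using iexp_approx1[of "u * X n" 0] by (intro add_mono) (auto simp: cis_conv_exp norm_mult abs_mult)
        finally have "norm (F u) * norm (?q (X n) u) \<le> norm (F u) * (2 * \<bar>u\<bar> * \<bar>X n\<bar>)"
          by (intro mult_left_mono) (auto simp: abs_mult)
        then show "norm (F u * ?q (X n) u / X n) \<le> 2 * norm (complex_of_real u * F u)"
          using X0[of n] by (simp only: norm_mult norm_divide norm_of_real) (simp add: pos_divide_le_eq mult_ac)
      qed
    qed (use uF in auto)
    then have "(\<lambda>n. norm (LINT u|lborel. F u * ?q (X n) u / X n)) \<longlonglongrightarrow> 0"
      by (simp add: tendsto_norm_zero)
    moreover have "norm (LINT u|lborel. F u * ?q (X n) u / X n) = norm (LINT u|lborel. F u * ?q (X n) u) / norm (X n)" for n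
      by (simp only: integral_divide_zero norm_divide norm_of_real real_norm_def)
    ultimately show "((\<lambda>h. norm (LINT u|lborel. F u * ?q h u) / norm h) \<circ> X) \<longlonglongrightarrow> 0"
      by (simp only: o_def)
  qed
qed

text \<open>
  Cauchy's theorem for a rectangle of height \<open>2n\<close>, in the form that \<open>H\<close> has a primitive \<open>P\<close> on the
  half-plane. The contribution of a horizontal side is a difference of two values of \<open>P\<close>, which tends
  to \<open>0\<close> by the mean value estimate and the decay of \<open>H\<close>.
\<close>

lemma vertical_line_integral_shift:
  fixes H :: "complex \<Rightarrow> complex"
  assumes holo: "H holomorphic_on {z. Re z > c}" and ab: "c < a" "a \<le> b"
    and bound: "\<And>\<sigma> s. \<sigma> \<in> {a..b} \<Longrightarrow> norm (H (Complex \<sigma> s)) \<le> C * inverse (1 + s\<^sup>2)"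
  shows "(LINT s|lborel. H (Complex a s)) = (LINT s|lborel. H (Complex b s))"
proof -
  let ?S = "{z. Re z > c}"
  have S: "open ?S" "convex ?S" by (auto simp: open_halfspace_Re_gt convex_halfspace_Re_gt)
  from holomorphic_convex_primitive'[OF S(2,1) holo] obtain P where
    P: "\<And>z. z \<in> ?S \<Longrightarrow> (P has_field_derivative H z) (at z within ?S)" by blast
  have P: "(P has_field_derivative H z) (at z)" if z: "Re z > c" for z
  proof -
    have "z \<in> ?S" using z by simp
    then show ?thesis using P[of z] at_within_open[OF _ S(1), of z] by metis
  qed
  have contH: "continuous_on UNIV (\<lambda>s. H (Complex \<sigma> s))" if "\<sigma> \<in> {a..b}" for \<sigma>
  proof (rule continuous_on_compose2[OF holomorphic_on_imp_continuous_on[OF holo]])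
    show "continuous_on UNIV (Complex \<sigma>)" by (simp add: Complex_eq continuous_intros)
  qed (use that ab in auto)
  have int: "integrable lborel (\<lambda>s. H (Complex \<sigma> s))" if "\<sigma> \<in> {a..b}" for \<sigma>
    using contH[OF that] bound[OF that]
    by (intro integrable_if_inverse_square_decay) (auto intro: borel_measurable_continuous_onI)
  have part: "(LINT s|lborel. indicator {-real n..real n} s *\<^sub>R H (Complex \<sigma> s))
      = - \<i> * (P (Complex \<sigma> (real n)) - P (Complex \<sigma> (- real n)))" if "\<sigma> \<in> {a..b}" for \<sigma> and n :: nat
  proof -
    have "(LINT s|lborel. indicator {-real n..real n} s *\<^sub>R H (Complex \<sigma> s))
      = - \<i> * P (Complex \<sigma> (real n)) - - \<i> * P (Complex \<sigma> (- real n))"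
    proof (rule integral_FTC_Icc)
      fix s :: real
      have "(P has_field_derivative H (Complex \<sigma> s)) (at (of_real \<sigma> + \<i> * of_real s))"
        using P[of "Complex \<sigma> s"] that ab by (simp add: Complex_eq)
      moreover have "((\<lambda>z. of_real \<sigma> + \<i> * z) has_field_derivative \<i>) (at (of_real s))"
        by (auto intro!: derivative_eq_intros)
      ultimately have "((\<lambda>z. - \<i> * P (of_real \<sigma> + \<i> * z)) has_field_derivative - \<i> * (H (Complex \<sigma> s) * \<i>)) (at (of_real s))"
        by (intro DERIV_cmult) (rule DERIV_chain2)
      moreover have "- \<i> * (X * \<i>) = X" for X :: complex by (simp add: mult.commute[of X])
      ultimately have "((\<lambda>z. - \<i> * P (of_real \<sigma> + \<i> * z)) has_field_derivative H (Complex \<sigma> s)) (at (of_real s))"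
        by simp
      from has_vector_derivative_real_field[OF this]
      show "((\<lambda>s. - \<i> * P (Complex \<sigma> s)) has_vector_derivative H (Complex \<sigma> s)) (at s within {- real n..real n})"
        by (simp only: Complex_eq)
    qed (auto intro: continuous_on_subset[OF contH[OF that]])
    then show ?thesis by (simp add: algebra_simps)
  qed
  have lim: "(\<lambda>n. LINT s|lborel. indicator {-real n..real n} s *\<^sub>R H (Complex \<sigma> s)) \<longlonglongrightarrow> (LINT s|lborel. H (Complex \<sigma> s))"
    if "\<sigma> \<in> {a..b}" for \<sigma>
  proof (rule integral_dominated_convergence[where w = "\<lambda>s. norm (H (Complex \<sigma> s))"])
    note [measurable] = borel_measurable_integrable[OF int[OF that]]
    show "(\<lambda>s. H (Complex \<sigma> s)) \<in> borel_measurable lborel" by simp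
    show "(\<lambda>s. indicator {-real n..real n} s *\<^sub>R H (Complex \<sigma> s)) \<in> borel_measurable lborel" for n :: nat
      by measurable
    show "integrable lborel (\<lambda>s. norm (H (Complex \<sigma> s)))" by (rule integrable_norm[OF int[OF that]])
    show "AE s in lborel. (\<lambda>n. indicator {-real n..real n} s *\<^sub>R H (Complex \<sigma> s)) \<longlonglongrightarrow> H (Complex \<sigma> s)"
    proof (rule AE_I2, rule tendsto_eventually)
      fix s
      show "\<forall>\<^sub>F n in sequentially. indicator {-real n..real n} s *\<^sub>R H (Complex \<sigma> s) = H (Complex \<sigma> s)"
        using eventually_ge_at_top[of "nat \<lceil>\<bar>s\<bar>\<rceil>"]
      proof eventually_elim
        case (elim n)
        then have "\<bar>s\<bar> \<le> real n" by linarith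
        then have "s \<in> {-real n..real n}" by auto
        then show ?case by simp
      qed
    qed
    show "AE s in lborel. norm (indicator {-real n..real n} s *\<^sub>R H (Complex \<sigma> s)) \<le> norm (H (Complex \<sigma> s))" for n :: nat
      by (rule AE_I2) (auto split: split_indicator)
  qed
  have gap: "norm (P (Complex b y) - P (Complex a y)) \<le> \<bar>C\<bar> * inverse (1 + y\<^sup>2) * (b - a)" for y
  proof -
    have seg: "\<exists>\<sigma>\<in>{a..b}. z = Complex \<sigma> y" if "z \<in> closed_segment (Complex a y) (Complex b y)" for z
      using that ab closed_segment_same_Im[of "Complex a y" "Complex b y"]
      by (auto simp: closed_segment_eq_real_ivl complex_eq_iff intro!: bexI[of _ "Re z"])
    have "norm (P (Complex b y) - P (Complex a y)) \<le> (\<bar>C\<bar> * inverse (1 + y\<^sup>2)) * norm (Complex b y - Complex a y)"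
    proof (rule field_differentiable_bound[where f' = H])
      fix z assume "z \<in> closed_segment (Complex a y) (Complex b y)"
      then obtain \<sigma> where \<sigma>: "\<sigma> \<in> {a..b}" "z = Complex \<sigma> y" using seg by blast
      have "c < Re z" using \<sigma> ab by simp
      then show "(P has_field_derivative H z) (at z within closed_segment (Complex a y) (Complex b y))"
        by (rule has_field_derivative_at_within[OF P])
      have "norm (H z) \<le> C * inverse (1 + y\<^sup>2)" using bound[OF \<sigma>(1)] \<sigma>(2) by simp
      also have "\<dots> \<le> \<bar>C\<bar> * inverse (1 + y\<^sup>2)" by (intro mult_right_mono) (auto simp: add_nonneg_nonneg)
      finally show "norm (H z) \<le> \<bar>C\<bar> * inverse (1 + y\<^sup>2)" .
    qed auto
    also have "Complex b y - Complex a y = complex_of_real (b - a)" by (simp add: complex_eq_iff)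
    also have "norm (complex_of_real (b - a)) = b - a" using ab by (simp only: norm_of_real)
    finally show ?thesis .
  qed
  have inv0: "(\<lambda>n. inverse (1 + (real n)\<^sup>2)) \<longlonglongrightarrow> 0" by real_asymp
  have "(\<lambda>n. (LINT s|lborel. indicator {-real n..real n} s *\<^sub>R H (Complex b s))
       - (LINT s|lborel. indicator {-real n..real n} s *\<^sub>R H (Complex a s))) \<longlonglongrightarrow> 0"
  proof (rule Lim_null_comparison)
    show "(\<lambda>n. 2 * (\<bar>C\<bar> * inverse (1 + (real n)\<^sup>2) * (b - a))) \<longlonglongrightarrow> 0"
      by (rule tendsto_eq_intros inv0 refl)+ simp
    show "\<forall>\<^sub>F n in sequentially. norm ((LINT s|lborel. indicator {-real n..real n} s *\<^sub>R H (Complex b s))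
       - (LINT s|lborel. indicator {-real n..real n} s *\<^sub>R H (Complex a s))) \<le> 2 * (\<bar>C\<bar> * inverse (1 + (real n)\<^sup>2) * (b - a))"
    proof (intro always_eventually allI)
      fix n :: nat
      have "(LINT s|lborel. indicator {-real n..real n} s *\<^sub>R H (Complex b s))
       - (LINT s|lborel. indicator {-real n..real n} s *\<^sub>R H (Complex a s))
       = - \<i> * ((P (Complex b (real n)) - P (Complex a (real n))) - (P (Complex b (- real n)) - P (Complex a (- real n))))"
        using ab by (subst (1 2) part) (auto simp: algebra_simps)
      then have "norm ((LINT s|lborel. indicator {-real n..real n} s *\<^sub>R H (Complex b s))
       - (LINT s|lborel. indicator {-real n..real n} s *\<^sub>R H (Complex a s)))
       = norm ((P (Complex b (real n)) - P (Complex a (real n))) - (P (Complex b (- real n)) - P (Complex a (- real n))))"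
        by (simp only: norm_mult norm_minus_cancel norm_ii mult_1)
      also have "\<dots> \<le> norm (P (Complex b (real n)) - P (Complex a (real n))) + norm (P (Complex b (- real n)) - P (Complex a (- real n)))"
        by (rule norm_triangle_ineq4)
      finally show "norm ((LINT s|lborel. indicator {-real n..real n} s *\<^sub>R H (Complex b s))
       - (LINT s|lborel. indicator {-real n..real n} s *\<^sub>R H (Complex a s))) \<le> 2 * (\<bar>C\<bar> * inverse (1 + (real n)\<^sup>2) * (b - a))"
        using gap[of "real n"] gap[of "- real n"] unfolding power2_minus by linarith
    qed
  qed
  moreover have "(\<lambda>n. (LINT s|lborel. indicator {-real n..real n} s *\<^sub>R H (Complex b s))
       - (LINT s|lborel. indicator {-real n..real n} s *\<^sub>R H (Complex a s)))
       \<longlonglongrightarrow> (LINT s|lborel. H (Complex b s)) - (LINT s|lborel. H (Complex a s))"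
    using ab by (intro tendsto_diff lim) auto
  ultimately show ?thesis using LIMSEQ_unique by fastforce
qed

text \<open>
  The decay is required for \<open>n = 0\<close> as well, so that boundedness on closed strips is an instance.
\<close>

definition rapidly_decreasing :: "(complex \<Rightarrow> complex) \<Rightarrow> bool" where
  "rapidly_decreasing G \<longleftrightarrow> G holomorphic_on {z. Re z > 1/2} \<and>
     (\<forall>n a b. 1/2 < a \<longrightarrow> a \<le> b \<longrightarrow>
        (\<exists>C. \<forall>s. \<forall>\<sigma>\<in>{a..b}. norm (G (Complex \<sigma> s)) * norm (Complex \<sigma> s) ^ n \<le> C))"

lemma rapidly_decreasing_mult_linear:
  assumes "rapidly_decreasing G"
  shows "rapidly_decreasing (\<lambda>z. (\<alpha> * z + \<beta>) * G z)"
  unfolding rapidly_decreasing_def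
proof (intro conjI allI impI)
  show "(\<lambda>z. (\<alpha> * z + \<beta>) * G z) holomorphic_on {z. Re z > 1/2}"
    using assms by (auto simp: rapidly_decreasing_def intro!: holomorphic_intros)
  fix n a b assume ab: "1/2 < (a::real)" "a \<le> b"
  obtain C1 C2 where
    C1: "\<And>s \<sigma>. \<sigma> \<in> {a..b} \<Longrightarrow> norm (G (Complex \<sigma> s)) * norm (Complex \<sigma> s) ^ Suc n \<le> C1"
    and C2: "\<And>s \<sigma>. \<sigma> \<in> {a..b} \<Longrightarrow> norm (G (Complex \<sigma> s)) * norm (Complex \<sigma> s) ^ n \<le> C2"
    using assms ab unfolding rapidly_decreasing_def by meson
  have "norm ((\<alpha> * Complex \<sigma> s + \<beta>) * G (Complex \<sigma> s)) * norm (Complex \<sigma> s) ^ n \<le> norm \<alpha> * C1 + norm \<beta> * C2"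
    if "\<sigma> \<in> {a..b}" for \<sigma> s
  proof -
    let ?z = "Complex \<sigma> s"
    have "norm ((\<alpha> * ?z + \<beta>) * G ?z) * norm ?z ^ n \<le> (norm \<alpha> * norm ?z + norm \<beta>) * norm (G ?z) * norm ?z ^ n"
      unfolding norm_mult using norm_triangle_ineq[of "\<alpha> * ?z" \<beta>]
      by (intro mult_right_mono) (auto simp: norm_mult)
    also have "\<dots> = norm \<alpha> * (norm (G ?z) * norm ?z ^ Suc n) + norm \<beta> * (norm (G ?z) * norm ?z ^ n)"
      by (simp add: algebra_simps)
    also have "\<dots> \<le> norm \<alpha> * C1 + norm \<beta> * C2"
      by (intro add_mono mult_left_mono C1 C2 that) auto
    finally show ?thesis .
  qed
  then show "\<exists>C. \<forall>s. \<forall>\<sigma>\<in>{a..b}. norm ((\<alpha> * Complex \<sigma> s + \<beta>) * G (Complex \<sigma> s)) * norm (Complex \<sigma> s) ^ n \<le> C"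
    by blast
qed

text \<open>
  The case \<open>k = 0\<close> is the existence of boundary values in \<open>L\<^sup>2\<close>, the others are their weighted forms.
\<close>

definition has_boundary_limits :: "(complex \<Rightarrow> complex) \<Rightarrow> bool" where
  "has_boundary_limits G \<longleftrightarrow>
     (\<forall>k. \<exists>h. L2_tendsto lborel (\<lambda>\<sigma> s. complex_of_real s ^ k * G (Complex \<sigma> s)) h (at_right (1/2)))"

lemma has_boundary_limits_mult_linear:
  assumes "has_boundary_limits G"
  shows "has_boundary_limits (\<lambda>z. (\<alpha> * z + \<beta>) * G z)"
  unfolding has_boundary_limits_def
proof
  fix k
  obtain h1 h2 where
    h1: "L2_tendsto lborel (\<lambda>\<sigma> s. complex_of_real s ^ k * G (Complex \<sigma> s)) h1 (at_right (1/2))"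
    and h2: "L2_tendsto lborel (\<lambda>\<sigma> s. complex_of_real s ^ Suc k * G (Complex \<sigma> s)) h2 (at_right (1/2))"
    using assms unfolding has_boundary_limits_def by meson
  have c: "((\<lambda>\<sigma>. \<alpha> * complex_of_real \<sigma> + \<beta>) \<longlongrightarrow> \<alpha> * complex_of_real (1/2) + \<beta>) (at_right (1/2))"
    by (intro tendsto_intros)
  have eq: "complex_of_real s ^ k * ((\<alpha> * Complex \<sigma> s + \<beta>) * G (Complex \<sigma> s))
     = (\<alpha> * complex_of_real \<sigma> + \<beta>) * (complex_of_real s ^ k * G (Complex \<sigma> s))
       + (\<alpha> * \<i>) * (complex_of_real s ^ Suc k * G (Complex \<sigma> s))" for \<sigma> s
  proof -
    have "(\<alpha> * Complex \<sigma> s + \<beta>) = (\<alpha> * complex_of_real \<sigma> + \<beta>) + (\<alpha> * \<i>) * complex_of_real s"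
      by (simp add: Complex_eq algebra_simps)
    then show ?thesis by (simp add: algebra_simps)
  qed
  show "\<exists>h. L2_tendsto lborel (\<lambda>\<sigma> s. complex_of_real s ^ k * ((\<alpha> * Complex \<sigma> s + \<beta>) * G (Complex \<sigma> s))) h (at_right (1/2))"
    unfolding eq using L2_tendsto_add[OF L2_tendsto_cmult[OF h1 c] L2_tendsto_cmult[OF h2 tendsto_const]] by blast
qed

lemma L2_tendsto_norm_bounded:
  assumes "L2_tendsto M F h \<F>"
  shows "\<exists>B. \<forall>\<^sub>F i in \<F>. (LINT x|M. (norm (F i x))\<^sup>2) \<le> B"
proof -
  note D = L2_tendstoD[OF assms]
  have "\<forall>\<^sub>F i in \<F>. (LINT x|M. (norm (F i x - h x))\<^sup>2) < 1"
    using D(3) by (rule order_tendstoD) simp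
  with D(2) have "\<forall>\<^sub>F i in \<F>. (LINT x|M. (norm (F i x))\<^sup>2) \<le> 2 * 1 + 2 * (LINT x|M. (norm (h x))\<^sup>2)"
  proof eventually_elim
    case (elim i)
    show ?case using L2_integral_add_le[OF L2_diff[OF elim(1) D(1)] D(1)] elim(2) by simp
  qed
  then show ?thesis by blast
qed

lemma exp_Complex_eq: "exp (- Complex \<sigma> s * complex_of_real u) = complex_of_real (exp (- \<sigma> * u)) * cis (s * - u)"
  by (simp add: exp_eq_polar mult.commute)

text \<open>
  The inverse Mellin transform at the point \<open>e\<^sup>u\<close>, along the line \<open>Re z = 1\<close>; for rapidly
  decreasing functions any other line in the half-plane \<open>Re z > 1/2\<close> gives the same value.
\<close>

definition inverse_Mellin_exp :: "(complex \<Rightarrow> complex) \<Rightarrow> real \<Rightarrow> complex" where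
  "inverse_Mellin_exp G u = (LINT s|lborel. G (Complex 1 s) * exp (- Complex 1 s * u)) / (2 * pi)"

context
  fixes G assumes G: "rapidly_decreasing G"
begin

lemma rapidly_decreasing_bound:
  assumes "1/2 < a" "a \<le> b"
  shows "\<exists>C. \<forall>s. \<forall>\<sigma>\<in>{a..b}. norm (G (Complex \<sigma> s)) \<le> C * inverse (1 + s\<^sup>2)"
proof -
  obtain C where C: "\<And>s \<sigma>. \<sigma> \<in> {a..b} \<Longrightarrow> norm (G (Complex \<sigma> s)) * norm (Complex \<sigma> s) ^ 2 \<le> C"
    using G assms unfolding rapidly_decreasing_def by meson
  have "norm (G (Complex \<sigma> s)) \<le> (4 * C) * inverse (1 + s\<^sup>2)" if "\<sigma> \<in> {a..b}" for \<sigma> s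
  proof -
    have "norm (G (Complex \<sigma> s)) * (1 + s\<^sup>2) \<le> norm (G (Complex \<sigma> s)) * (4 * (norm (Complex \<sigma> s))\<^sup>2)"
      using that assms by (intro mult_left_mono one_plus_square_le_norm) auto
    also have "\<dots> \<le> 4 * C" using C[OF that, of s] by simp
    finally show ?thesis by (simp add: field_simps add_pos_nonneg)
  qed
  then show ?thesis by blast
qed

lemma rapidly_decreasing_line:
  assumes "1/2 < \<sigma>"
  shows "continuous_on UNIV (\<lambda>s. G (Complex \<sigma> s))" and "integrable lborel (\<lambda>s. G (Complex \<sigma> s))"
    and "\<exists>B. \<forall>s. norm (G (Complex \<sigma> s)) \<le> B"
proof -
  obtain C where C: "\<And>s. norm (G (Complex \<sigma> s)) \<le> C * inverse (1 + s\<^sup>2)"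
    using rapidly_decreasing_bound[OF assms order.refl] by auto
  have holo: "G holomorphic_on {z. Re z > 1/2}" using G by (simp add: rapidly_decreasing_def)
  show c: "continuous_on UNIV (\<lambda>s. G (Complex \<sigma> s))"
  proof (rule continuous_on_compose2[OF holomorphic_on_imp_continuous_on[OF holo]])
    show "continuous_on UNIV (Complex \<sigma>)" by (simp add: Complex_eq continuous_intros)
  qed (use assms in auto)
  show "integrable lborel (\<lambda>s. G (Complex \<sigma> s))"
    using c C by (intro integrable_if_inverse_square_decay) (auto intro: borel_measurable_continuous_onI)
  obtain B where "\<And>s. norm (G (Complex \<sigma> s)) * norm (Complex \<sigma> s) ^ 0 \<le> B"
    using G assms order.refl[of \<sigma>] unfolding rapidly_decreasing_def by (meson atLeastAtMost_iff)
  then show "\<exists>B. \<forall>s. norm (G (Complex \<sigma> s)) \<le> B" by auto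
qed

lemma inverse_Mellin_exp_eq:
  assumes \<sigma>: "1/2 < \<sigma>"
  shows "complex_of_real (2 * pi) * inverse_Mellin_exp G u
    = complex_of_real (exp (- \<sigma> * u)) * fourier (\<lambda>s. G (Complex \<sigma> s)) (- u)"
proof -
  let ?H = "\<lambda>z. G z * exp (- z * complex_of_real u)"
  have shift: "(LINT s|lborel. ?H (Complex a s)) = (LINT s|lborel. ?H (Complex b s))" if ab: "1/2 < a" "a \<le> b" for a b
  proof -
    obtain C where C: "\<And>s \<sigma>. \<sigma> \<in> {a..b} \<Longrightarrow> norm (G (Complex \<sigma> s)) \<le> C * inverse (1 + s\<^sup>2)"
      using rapidly_decreasing_bound[OF ab] by blast
    have "?H holomorphic_on {z. Re z > 1/2}"
      using G by (auto simp: rapidly_decreasing_def intro!: holomorphic_intros)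
    then show ?thesis
    proof (rule vertical_line_integral_shift[OF _ ab])
      fix \<sigma> s assume \<sigma>: "\<sigma> \<in> {a..b}"
      have le: "exp (- \<sigma> * u) \<le> exp (- a * u) + exp (- b * u)"
        using exp_between_le[of a \<sigma> b "- u"] \<sigma> by simp
      have "norm (?H (Complex \<sigma> s)) = norm (G (Complex \<sigma> s)) * exp (- \<sigma> * u)"
        unfolding exp_Complex_eq by (simp add: norm_mult)
      also have "\<dots> \<le> (C * inverse (1 + s\<^sup>2)) * (exp (- a * u) + exp (- b * u))"
        using C[OF \<sigma>, of s] by (intro mult_mono le) (auto intro: order.trans[OF norm_ge_zero])
      finally show "norm (?H (Complex \<sigma> s)) \<le> (C * (exp (- a * u) + exp (- b * u))) * inverse (1 + s\<^sup>2)"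
        by (simp add: mult_ac)
    qed
  qed
  have "(LINT s|lborel. ?H (Complex 1 s)) = (LINT s|lborel. ?H (Complex \<sigma> s))"
    using shift[of 1 \<sigma>] shift[of \<sigma> 1] \<sigma> by (cases "\<sigma> \<le> 1") auto
  also have "\<dots> = complex_of_real (exp (- \<sigma> * u)) * fourier (\<lambda>s. G (Complex \<sigma> s)) (- u)"
    unfolding exp_Complex_eq fourier_def
    by (subst integral_mult_right_zero[symmetric]) (simp add: mult_ac)
  finally show ?thesis unfolding inverse_Mellin_exp_def by simp
qed

lemma fourier_line_eq:
  assumes \<sigma>: "1/2 < \<sigma>"
  shows "fourier (\<lambda>s. G (Complex \<sigma> s)) t = complex_of_real (2 * pi) * (exp (\<sigma> * - t) *\<^sub>R inverse_Mellin_exp G (- t))"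
proof -
  have "exp (\<sigma> * - t) *\<^sub>R (complex_of_real (2 * pi) * inverse_Mellin_exp G (- t))
     = fourier (\<lambda>s. G (Complex \<sigma> s)) t"
    unfolding inverse_Mellin_exp_eq[OF \<sigma>]
    by (simp add: scaleR_conv_of_real mult.assoc[symmetric] exp_minus flip: of_real_mult)
  then show ?thesis by (simp add: scaleR_conv_of_real mult_ac)
qed

lemma inverse_Mellin_exp_bound:
  assumes \<sigma>: "1/2 < \<sigma>"
  shows "\<exists>K. \<forall>u. norm (inverse_Mellin_exp G u) \<le> K * exp (- \<sigma> * u)"
proof -
  let ?K = "(LINT s|lborel. norm (G (Complex \<sigma> s)))"
  have "norm (inverse_Mellin_exp G u) \<le> ?K * exp (- \<sigma> * u)" for u
  proof -
    have "norm (inverse_Mellin_exp G u) \<le> 2 * pi * norm (inverse_Mellin_exp G u)"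
      using pi_gt3 mult_right_mono[of 1 "2 * pi" "norm (inverse_Mellin_exp G u)"] by simp
    also have "\<dots> = norm (complex_of_real (2 * pi) * inverse_Mellin_exp G u)" by (simp add: norm_mult)
    also have "\<dots> = exp (- \<sigma> * u) * norm (fourier (\<lambda>s. G (Complex \<sigma> s)) (- u))"
      unfolding inverse_Mellin_exp_eq[OF \<sigma>] by (simp add: norm_mult)
    also have "\<dots> \<le> exp (- \<sigma> * u) * ?K" by (intro mult_left_mono norm_fourier_le) auto
    finally show ?thesis by (simp add: mult.commute)
  qed
  then show ?thesis by blast
qed

text \<open>
  Estimating along the lines \<open>\<sigma> - d\<close> for negative \<open>u\<close> and \<open>\<sigma> + d\<close> for positive \<open>u\<close> gives
  exponential decay in both directions.
\<close>

lemma inverse_Mellin_exp_integrable: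
  assumes \<sigma>: "1/2 < \<sigma>"
  shows "integrable lborel (\<lambda>u. exp (\<sigma> * u) *\<^sub>R inverse_Mellin_exp G u)"
    and "integrable lborel (fourier (\<lambda>s. G (Complex \<sigma> s)))"
proof -
  define d where "d = (\<sigma> - 1/2) / 2"
  have d: "d > 0" "1/2 < \<sigma> - d" "1/2 < \<sigma> + d" using \<sigma> by (auto simp: d_def field_simps)
  obtain K1 K2 where K1: "\<And>u. norm (inverse_Mellin_exp G u) \<le> K1 * exp (- (\<sigma> - d) * u)"
    and K2: "\<And>u. norm (inverse_Mellin_exp G u) \<le> K2 * exp (- (\<sigma> + d) * u)"
    using inverse_Mellin_exp_bound[OF d(2)] inverse_Mellin_exp_bound[OF d(3)] by blast
  have K: "0 \<le> K1" "0 \<le> K2" using order.trans[OF norm_ge_zero K1[of 0]] order.trans[OF norm_ge_zero K2[of 0]] by auto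
  have bound: "norm (exp (\<sigma> * u) *\<^sub>R inverse_Mellin_exp G u) \<le> (K1 + K2) * exp (- d * \<bar>u\<bar>)" for u
  proof (cases "u \<ge> 0")
    case True
    have "norm (exp (\<sigma> * u) *\<^sub>R inverse_Mellin_exp G u) \<le> exp (\<sigma> * u) * (K2 * exp (- (\<sigma> + d) * u))"
      using K2[of u] by simp
    also have "\<dots> = K2 * exp (- d * \<bar>u\<bar>)" using True by (simp add: exp_add[symmetric] algebra_simps)
    also have "\<dots> \<le> (K1 + K2) * exp (- d * \<bar>u\<bar>)" using K by (intro mult_right_mono) auto
    finally show ?thesis .
  next
    case False
    have "norm (exp (\<sigma> * u) *\<^sub>R inverse_Mellin_exp G u) \<le> exp (\<sigma> * u) * (K1 * exp (- (\<sigma> - d) * u))"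
      using K1[of u] by simp
    also have "\<dots> = K1 * exp (- d * \<bar>u\<bar>)" using False by (simp add: exp_add[symmetric] algebra_simps)
    also have "\<dots> \<le> (K1 + K2) * exp (- d * \<bar>u\<bar>)" using K by (intro mult_right_mono) auto
    finally show ?thesis .
  qed
  have [measurable]: "fourier (\<lambda>s. G (Complex \<sigma> s)) \<in> borel_measurable borel"
    using borel_measurable_integrable[OF rapidly_decreasing_line(2)[OF \<sigma>]] by simp
  have m: "(\<lambda>u. exp (\<sigma> * u) *\<^sub>R inverse_Mellin_exp G u) \<in> borel_measurable borel"
  proof -
    have "(\<lambda>u. exp (\<sigma> * u) *\<^sub>R inverse_Mellin_exp G u) = (\<lambda>u. fourier (\<lambda>s. G (Complex \<sigma> s)) (- u) / (2 * pi))"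
      by (simp add: fun_eq_iff fourier_line_eq[OF \<sigma>] scaleR_conv_of_real)
    then show ?thesis by simp
  qed
  show i: "integrable lborel (\<lambda>u. exp (\<sigma> * u) *\<^sub>R inverse_Mellin_exp G u)"
  proof (rule Bochner_Integration.integrable_bound)
    show "integrable lborel (\<lambda>u. (K1 + K2) * exp (- d * \<bar>u\<bar>))"
      using integrable_exp_neg_abs[OF d(1)] by simp
    show "AE u in lborel. norm (exp (\<sigma> * u) *\<^sub>R inverse_Mellin_exp G u) \<le> norm ((K1 + K2) * exp (- d * \<bar>u\<bar>))"
      using order.trans[OF bound abs_ge_self] by simp
  qed (use m in simp)
  from lborel_integrable_real_affine[OF i, of "-1" 0]
  show "integrable lborel (fourier (\<lambda>s. G (Complex \<sigma> s)))"
    unfolding fourier_line_eq[OF \<sigma>, abs_def] by (intro integrable_mult_right) simp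
qed

lemma fourier_inverse_Mellin_exp:
  assumes \<sigma>: "1/2 < \<sigma>"
  shows "fourier (\<lambda>u. exp (\<sigma> * u) *\<^sub>R inverse_Mellin_exp G u) s = G (Complex \<sigma> s)"
proof -
  note line = rapidly_decreasing_line[OF \<sigma>]
  let ?E = "\<lambda>u. exp (\<sigma> * u) *\<^sub>R inverse_Mellin_exp G u"
  obtain B where B: "\<And>s. norm (G (Complex \<sigma> s)) \<le> B" using line(3) by blast
  have "2 * pi * G (Complex \<sigma> s) = (LINT t|lborel. fourier (\<lambda>s. G (Complex \<sigma> s)) t * cis (- t * s))"
    using fourier_inversion[OF line(2,1) B inverse_Mellin_exp_integrable(2)[OF \<sigma>], of s] by simp
  also have "\<dots> = (LINT t|lborel. 2 * pi * (?E (- t) * cis (- t * s)))"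
    unfolding fourier_line_eq[OF \<sigma>] by (simp add: mult.assoc)
  also have "\<dots> = (LINT u|lborel. 2 * pi * (?E u * cis (u * s)))"
    using lborel_integral_real_affine[of "-1" "\<lambda>u. 2 * pi * (?E u * cis (u * s))" 0] by simp
  also have "\<dots> = 2 * pi * fourier ?E s" unfolding fourier_def by (rule integral_mult_right_zero)
  finally show ?thesis by simp
qed

lemma plancherel_inverse_Mellin_exp:
  assumes \<sigma>: "1/2 < \<sigma>"
  shows "integrable lborel (\<lambda>u. (norm (exp (\<sigma> * u) *\<^sub>R inverse_Mellin_exp G u))\<^sup>2)"
    and "2 * pi * (LINT u|lborel. (norm (exp (\<sigma> * u) *\<^sub>R inverse_Mellin_exp G u))\<^sup>2) = (LINT s|lborel. (norm (G (Complex \<sigma> s)))\<^sup>2)"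
proof -
  note line = rapidly_decreasing_line[OF \<sigma>]
  let ?E = "\<lambda>u. exp (\<sigma> * u) *\<^sub>R inverse_Mellin_exp G u"
  obtain B where B: "\<And>s. norm (G (Complex \<sigma> s)) \<le> B" using line(3) by blast
  note p = plancherel[OF line(2,1) B inverse_Mellin_exp_integrable(2)[OF \<sigma>]]
  have n: "(norm (fourier (\<lambda>s. G (Complex \<sigma> s)) t))\<^sup>2 = (2 * pi)\<^sup>2 * (norm (?E (- t)))\<^sup>2" for t
    unfolding fourier_line_eq[OF \<sigma>] by (simp add: norm_mult power_mult_distrib)
  have "integrable lborel (\<lambda>t. (norm (?E (- t)))\<^sup>2)"
    using p(2) unfolding n integrable_mult_left_iff by simp
  from lborel_integrable_real_affine[OF this, of "-1" 0]
  show "integrable lborel (\<lambda>u. (norm (?E u))\<^sup>2)" by simp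
  have "2 * pi * (LINT s|lborel. (norm (G (Complex \<sigma> s)))\<^sup>2) = (2 * pi)\<^sup>2 * (LINT t|lborel. (norm (?E (- t)))\<^sup>2)"
    using p(3) unfolding n by simp
  also have "(LINT t|lborel. (norm (?E (- t)))\<^sup>2) = (LINT u|lborel. (norm (?E u))\<^sup>2)"
    using lborel_integral_real_affine[of "-1" "\<lambda>u. (norm (?E u))\<^sup>2" 0] by simp
  finally have "2 * pi * (LINT s|lborel. (norm (G (Complex \<sigma> s)))\<^sup>2) = (2 * pi) * (2 * pi * (LINT u|lborel. (norm (?E u))\<^sup>2))"
    by (simp add: power2_eq_square)
  then show "2 * pi * (LINT u|lborel. (norm (?E u))\<^sup>2) = (LINT s|lborel. (norm (G (Complex \<sigma> s)))\<^sup>2)"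
    by (subst (asm) mult_cancel_left) simp
qed

end

lemma inverse_Mellin_exp_eq_1:
  assumes "rapidly_decreasing G"
  shows "inverse_Mellin_exp G u = exp (- u) *\<^sub>R (inverse (complex_of_real (2 * pi)) * fourier (\<lambda>s. G (Complex 1 s)) (- u))"
  using inverse_Mellin_exp_eq[OF assms, of 1 u] by (simp add: field_simps scaleR_conv_of_real)

lemma inverse_Mellin_exp_derivative:
  assumes G: "rapidly_decreasing G"
  shows "(inverse_Mellin_exp G has_vector_derivative inverse_Mellin_exp (\<lambda>z. - z * G z) u) (at u)"
proof -
  have H: "rapidly_decreasing (\<lambda>z. - z * G z)"
    using rapidly_decreasing_mult_linear[OF G, of "-1" 0] by simp
  have one: "1/2 < (1::real)" by simp
  define F where "F s = G (Complex 1 s)" for s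
  define A where "A s = - Complex 1 s * G (Complex 1 s)" for s
  have F: "integrable lborel F" unfolding F_def by (rule rapidly_decreasing_line(2)[OF G one])
  have A: "integrable lborel A" unfolding A_def by (rule rapidly_decreasing_line(2)[OF H one])
  have sF: "(\<lambda>s. complex_of_real s * F s) = (\<lambda>s. \<i> * A s + \<i> * F s)"
    by (simp add: fun_eq_iff F_def A_def Complex_eq algebra_simps)
  have "integrable lborel (\<lambda>s. complex_of_real s * F s)" unfolding sF using A F by simp
  note fourier_has_vector_derivative[OF F this, of "- u"]
  moreover have "(\<lambda>s. \<i> * (complex_of_real s * F s)) = (\<lambda>s. (- 1) * A s + (- 1) * F s)"
    by (simp add: fun_cong[OF sF] fun_eq_iff distrib_left)
  ultimately have "(fourier F has_vector_derivative fourier (\<lambda>s. (- 1) * A s + (- 1) * F s) (- u)) (at (- u))"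
    by simp
  also have "fourier (\<lambda>s. (- 1) * A s + (- 1) * F s) (- u) = - fourier A (- u) - fourier F (- u)"
  proof -
    have "integrable lborel (\<lambda>s. (- 1) * A s)" "integrable lborel (\<lambda>s. (- 1) * F s)"
      using A F by simp_all
    from fourier_add[OF this] show ?thesis unfolding fourier_cmult by simp
  qed
  finally have "(fourier F has_vector_derivative - fourier A (- u) - fourier F (- u)) (at (- u))" .
  moreover have "(uminus has_vector_derivative - 1) (at u)"
    using has_vector_derivative_minus[OF has_vector_derivative_id] by simp
  ultimately have "(fourier F \<circ> uminus has_vector_derivative - 1 *\<^sub>R (- fourier A (- u) - fourier F (- u))) (at u)"
    by (intro vector_diff_chain_at)
  moreover have "- 1 *\<^sub>R (- fourier A (- u) - fourier F (- u)) = fourier A (- u) + fourier F (- u)" by simp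
  ultimately have "((\<lambda>u. fourier F (- u)) has_vector_derivative fourier A (- u) + fourier F (- u)) (at u)"
    by (simp only: o_def)
  then have B: "((\<lambda>u. inverse (complex_of_real (2 * pi)) * fourier F (- u)) has_vector_derivative
      inverse (complex_of_real (2 * pi)) * (fourier A (- u) + fourier F (- u))) (at u)"
    by (rule has_vector_derivative_mult_right)
  have "((\<lambda>u. exp (- u)) has_real_derivative - exp (- u)) (at u)"
    by (auto intro!: derivative_eq_intros)
  from has_vector_derivative_scaleR[OF this B]
  have "((\<lambda>u. exp (- u) *\<^sub>R (inverse (complex_of_real (2 * pi)) * fourier F (- u))) has_vector_derivative
     exp (- u) *\<^sub>R (inverse (complex_of_real (2 * pi)) * fourier A (- u))) (at u)"
    by (simp add: algebra_simps)
  then show ?thesis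
    unfolding inverse_Mellin_exp_eq_1[OF H] inverse_Mellin_exp_eq_1[OF G, abs_def] F_def A_def .
qed

lemma inverse_Mellin_exp_mult_linear:
  assumes G: "rapidly_decreasing G"
  shows "inverse_Mellin_exp (\<lambda>z. - z * G z) u - of_nat n * inverse_Mellin_exp G u
    = inverse_Mellin_exp (\<lambda>z. (- 1 * z + - of_nat n) * G z) u"
proof -
  have H: "rapidly_decreasing (\<lambda>z. - z * G z)" "rapidly_decreasing (\<lambda>z. (- 1 * z + - of_nat n) * G z)"
    using rapidly_decreasing_mult_linear[OF G, of "-1" 0] rapidly_decreasing_mult_linear[OF G, of "-1" "- of_nat n"]
    by simp_all
  have one: "1/2 < (1::real)" by simp
  have "fourier (\<lambda>s. (- 1 * Complex 1 s + - of_nat n) * G (Complex 1 s)) (- u)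
      = fourier (\<lambda>s. - Complex 1 s * G (Complex 1 s) - of_nat n * G (Complex 1 s)) (- u)"
    by (simp only: distrib_right mult_minus_left mult_1_left diff_conv_add_uminus)
  also have "\<dots> = fourier (\<lambda>s. - Complex 1 s * G (Complex 1 s)) (- u) - of_nat n * fourier (\<lambda>s. G (Complex 1 s)) (- u)"
    using rapidly_decreasing_line(2)[OF H(1) one] rapidly_decreasing_line(2)[OF G one]
    by (subst fourier_diff) (auto simp only: fourier_cmult integrable_mult_right)
  finally show ?thesis
    unfolding inverse_Mellin_exp_eq_1[OF H(1)] inverse_Mellin_exp_eq_1[OF H(2)] inverse_Mellin_exp_eq_1[OF G]
    by (simp only: right_diff_distrib scaleR_conv_of_real mult_ac)
qed

text \<open>
  Under the inverse Mellin transform, \<open>x d/dx\<close> becomes multiplication by \<open>-z\<close>, and the factor \<open>x\<^sup>-\<^sup>n\<close>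
  contributes another \<open>-n\<close>. This is the step from the \<open>n\<close>-th derivative to the next one.
\<close>

lemma inverse_Mellin_derivative:
  assumes G: "rapidly_decreasing G" and x: "x > 0"
  shows "((\<lambda>x. inverse (x ^ n) *\<^sub>R inverse_Mellin_exp G (ln x)) has_vector_derivative
     inverse (x ^ Suc n) *\<^sub>R inverse_Mellin_exp (\<lambda>z. (- 1 * z + - of_nat n) * G z) (ln x)) (at x)"
proof -
  have "(ln has_vector_derivative inverse x) (at x)"
    using DERIV_ln[OF x] by (simp add: has_real_derivative_iff_has_vector_derivative)
  from vector_diff_chain_at[OF this inverse_Mellin_exp_derivative[OF G]]
  have J: "((\<lambda>x. inverse_Mellin_exp G (ln x)) has_vector_derivative
      inverse x *\<^sub>R inverse_Mellin_exp (\<lambda>z. - z * G z) (ln x)) (at x)" by (simp add: o_def)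
  have "((\<lambda>x. inverse (x ^ n)) has_real_derivative - (real n * inverse (x ^ Suc n))) (at x)"
  proof (rule DERIV_cong)
    show "((\<lambda>x. inverse (x ^ n)) has_real_derivative - (real n * x ^ (n - Suc 0) * inverse ((x ^ n) ^ Suc (Suc 0)))) (at x)"
      using x by (intro DERIV_inverse_fun DERIV_pow) simp
    show "- (real n * x ^ (n - Suc 0) * inverse ((x ^ n) ^ Suc (Suc 0))) = - (real n * inverse (x ^ Suc n))"
      using x by (cases n) (simp_all add: field_simps)
  qed
  from has_vector_derivative_scaleR[OF this J]
  have "((\<lambda>x. inverse (x ^ n) *\<^sub>R inverse_Mellin_exp G (ln x)) has_vector_derivative
     inverse (x ^ Suc n) *\<^sub>R (inverse_Mellin_exp (\<lambda>z. - z * G z) (ln x) - of_nat n * inverse_Mellin_exp G (ln x))) (at x)"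
    by (simp add: scaleR_conv_of_real algebra_simps)
  then show ?thesis unfolding inverse_Mellin_exp_mult_linear[OF G] .
qed

text \<open>
  The hypotheses say nothing about values of \<open>G\<close> on the line \<open>Re z = 1/2\<close>, so Plancherel is applied on
  lines approaching it. Boundary limits give a uniform bound there, and Fatou's lemma carries it
  over to \<open>\<sigma> = 1/2\<close>.
\<close>

lemma inverse_Mellin_exp_boundary_L2:
  assumes G: "rapidly_decreasing G" and lim: "has_boundary_limits G"
  shows "integrable lborel (\<lambda>u. (norm (exp (1/2 * u) *\<^sub>R inverse_Mellin_exp G u))\<^sup>2)"
proof -
  obtain h where "L2_tendsto lborel (\<lambda>\<sigma> s. complex_of_real s ^ 0 * G (Complex \<sigma> s)) h (at_right (1/2))"
    using lim unfolding has_boundary_limits_def by blast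
  from L2_tendsto_norm_bounded[OF this] obtain B where
    B: "\<forall>\<^sub>F \<sigma> in at_right (1/2). (LINT s|lborel. (norm (G (Complex \<sigma> s)))\<^sup>2) \<le> B" by auto
  define S where "S n = 1/2 + inverse (real (Suc n))" for n
  have S: "1/2 < S n" for n by (simp add: S_def)
  have Slim: "S \<longlonglongrightarrow> 1/2" and "filterlim S (at_right (1/2)) sequentially"
    using at_right_sequence[of "1/2"] by (simp_all add: S_def[abs_def])
  then have BS: "\<forall>\<^sub>F n in sequentially. (LINT s|lborel. (norm (G (Complex (S n) s)))\<^sup>2) \<le> B"
    using B unfolding filterlim_iff by blast
  let ?E = "\<lambda>\<sigma> u. (norm (exp (\<sigma> * u) *\<^sub>R inverse_Mellin_exp G u))\<^sup>2"
  have cont: "continuous_on UNIV (inverse_Mellin_exp G)"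
    by (rule continuous_at_imp_continuous_on) (use inverse_Mellin_exp_derivative[OF G] has_vector_derivative_continuous in blast)
  then have [measurable]: "inverse_Mellin_exp G \<in> borel_measurable borel" by (rule borel_measurable_continuous_onI)
  have "(\<integral>\<^sup>+u. ennreal (?E (1/2) u) \<partial>lborel) = (\<integral>\<^sup>+u. liminf (\<lambda>n. ennreal (?E (S n) u)) \<partial>lborel)"
  proof (rule nn_integral_cong)
    fix u
    have "(\<lambda>n. ennreal (?E (S n) u)) \<longlonglongrightarrow> ennreal (?E (1/2) u)"
      by (intro tendsto_intros Slim)
    then show "ennreal (?E (1/2) u) = liminf (\<lambda>n. ennreal (?E (S n) u))"
      by (rule lim_imp_Liminf[OF trivial_limit_sequentially, symmetric])
  qed
  also have "\<dots> \<le> liminf (\<lambda>n. \<integral>\<^sup>+u. ennreal (?E (S n) u) \<partial>lborel)"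
    by (rule nn_integral_liminf) measurable
  also have "\<dots> \<le> liminf (\<lambda>n. ennreal (B / (2 * pi)))"
  proof (rule Liminf_mono)
    show "\<forall>\<^sub>F n in sequentially. (\<integral>\<^sup>+u. ennreal (?E (S n) u) \<partial>lborel) \<le> ennreal (B / (2 * pi))"
      using BS
    proof eventually_elim
      case (elim n)
      note p = plancherel_inverse_Mellin_exp[OF G S[of n]]
      have "(\<integral>\<^sup>+u. ennreal (?E (S n) u) \<partial>lborel) = ennreal (LINT u|lborel. ?E (S n) u)"
        by (rule nn_integral_eq_integral[OF p(1)]) simp
      also have "\<dots> \<le> ennreal (B / (2 * pi))"
        using p(2) elim by (intro ennreal_leI) (simp add: pos_le_divide_eq mult.commute)
      finally show ?case .
    qed
  qed
  also have "\<dots> = ennreal (B / (2 * pi))" by (simp add: Liminf_const)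
  finally have "(\<integral>\<^sup>+u. ennreal (?E (1/2) u) \<partial>lborel) < \<infinity>"
    using ennreal_less_top order.strict_trans1 by fastforce
  then show ?thesis by (intro integrableI_bounded) auto
qed

theorem inverse_Mellin_smooth_vector:
  assumes g: "rapidly_decreasing g" and lim: "has_boundary_limits g"
  defines "f \<equiv> \<lambda>x. inverse_Mellin_exp g (ln x)"
  shows "f \<in> smooth_vectors" and "1/2 < \<sigma> \<Longrightarrow> Mellin f (Complex \<sigma> s) = g (Complex \<sigma> s)"
proof -
  \<comment> \<open>The inverse Mellin transform of \<open>Q n\<close> will be \<open>x\<^sup>n\<close> times the \<open>n\<close>-th derivative of \<open>f\<close>.\<close>
  define Q where "Q n z = (- 1) ^ n * pochhammer z n * g z" for n z
  have Q_Suc: "Q (Suc n) = (\<lambda>z. (- 1 * z + - of_nat n) * Q n z)" for n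
    by (simp add: fun_eq_iff Q_def pochhammer_Suc algebra_simps)
  have Q0: "Q 0 = g" by (simp add: fun_eq_iff Q_def)
  have Q: "rapidly_decreasing (Q n) \<and> has_boundary_limits (Q n)" for n
  proof (induction n)
    case (Suc n)
    then show ?case unfolding Q_Suc
      using rapidly_decreasing_mult_linear has_boundary_limits_mult_linear by blast
  qed (use g lim Q0 in simp)
  define D where "D n x = inverse (x ^ n) *\<^sub>R inverse_Mellin_exp (Q n) (ln x)" for n x
  have f0: "f x = D 0 x" for x by (simp add: f_def D_def Q0)
  have D: "(D n has_vector_derivative D (Suc n) x) (at x)" if "x > 0" for n x
    using inverse_Mellin_derivative[of "Q n" x n] Q that
    unfolding D_def[abs_def] Q_Suc by blast
  have smooth: "smooth_on_pos f" "nth_derivative n f x = D n x" if "x > 0" for n x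
    using smooth_on_posI[of f D] f0 D that by blast+
  have cont: "continuous_on UNIV (inverse_Mellin_exp (Q n))" for n
    by (rule continuous_at_imp_continuous_on)
       (use inverse_Mellin_exp_derivative[of "Q n"] Q has_vector_derivative_continuous in blast)
  have contl: "continuous_on {0<..} (\<lambda>x. inverse_Mellin_exp (Q n) (ln x))" for n
    by (intro continuous_on_compose2[OF cont] continuous_intros) auto
  have pb: "log_pullback \<sigma> (\<lambda>x. inverse_Mellin_exp (Q n) (ln x)) = (\<lambda>u. exp (\<sigma> * u) *\<^sub>R inverse_Mellin_exp (Q n) u)" for n \<sigma>
    by (simp add: fun_eq_iff log_pullback_def)
  have "(\<lambda>x. x ^ m *\<^sub>R nth_derivative n f x) \<in> L2 (restrict_space lborel {0<..})" if "n \<le> m" for m n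
  proof -
    have "(\<lambda>x. x ^ m *\<^sub>R nth_derivative n f x) \<in> L2 (restrict_space lborel {0<..}) \<longleftrightarrow>
       (\<lambda>x. x ^ (m - n) *\<^sub>R inverse_Mellin_exp (Q n) (ln x)) \<in> L2 (restrict_space lborel {0<..})"
    proof (rule L2_cong)
      fix x :: real assume "x \<in> space (restrict_space lborel {0<..})"
      then have x: "x > 0" by (simp add: space_restrict_space)
      have "x ^ m = x ^ (m - n) * x ^ n" using that by (simp flip: power_add)
      then show "x ^ m *\<^sub>R nth_derivative n f x = x ^ (m - n) *\<^sub>R inverse_Mellin_exp (Q n) (ln x)"
        using x by (simp add: smooth(2)[OF x] D_def)
    qed
    also have "\<dots> \<longleftrightarrow> integrable lborel (\<lambda>u. (norm (exp ((real (m - n) + 1/2) * u) *\<^sub>R inverse_Mellin_exp (Q n) u))\<^sup>2)"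
      unfolding weighted_L2_iff[OF contl] pb ..
    also have "\<dots>"
    proof (cases "m - n = 0")
      case True
      then show ?thesis using inverse_Mellin_exp_boundary_L2[of "Q n"] Q by simp
    next
      case False
      then show ?thesis using Q by (intro plancherel_inverse_Mellin_exp(1)) auto
    qed
    finally show ?thesis .
  qed
  then show "f \<in> smooth_vectors" using smooth(1)[OF zero_less_one] by (simp add: smooth_vectors_def)
  assume \<sigma>: "1/2 < \<sigma>"
  have pf: "log_pullback \<sigma> f = (\<lambda>u. exp (\<sigma> * u) *\<^sub>R inverse_Mellin_exp g u)"
    using pb[of \<sigma> 0] by (simp add: Q0 f_def)
  have "continuous_on {0<..} f" using contl[of 0] by (simp add: Q0 f_def)
  moreover have "integrable lborel (log_pullback \<sigma> f)"
    unfolding pf by (rule inverse_Mellin_exp_integrable(1)[OF g \<sigma>])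
  ultimately have "Mellin f (Complex \<sigma> s) = fourier (log_pullback \<sigma> f) s"
    by (rule Mellin_eq_fourier)
  then show "Mellin f (Complex \<sigma> s) = g (Complex \<sigma> s)"
    unfolding pf fourier_inverse_Mellin_exp[OF g \<sigma>] .
qed

section \<open>Characterisation of the Mellin transforms of smooth vectors\<close>

theorem theorem1p1:
  fixes g :: "complex \<Rightarrow> complex"
  assumes "g analytic_on {z. Re z > 1/2}"
  shows "(\<exists>f\<in>smooth_vectors. \<forall>z\<in>{z. Re z > 1/2}. g z = Mellin f z) \<longleftrightarrow>
    ((\<forall>n::nat. n > 0 \<longrightarrow> (\<forall>a b::real. 1/2 < a \<and> a \<le> b \<longrightarrow>
        (\<exists>C::real. \<forall>s\<^sub>1::real. \<forall>\<sigma>\<in>{a..b}.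
           norm (g (Complex \<sigma> s\<^sub>1)) \<le> C * norm (Complex \<sigma> s\<^sub>1) powi (- int n)))) \<and>
     (\<exists>h. L2_tendsto lborel (\<lambda>\<sigma> s\<^sub>1. g (Complex \<sigma> s\<^sub>1)) h (at_right (1/2))) \<and>
     (\<forall>n::nat. n \<ge> 1 \<longrightarrow>
        (\<exists>h. L2_tendsto lborel
           (\<lambda>\<sigma> s\<^sub>1. complex_of_real s\<^sub>1 ^ n * g (Complex \<sigma> s\<^sub>1)) h (at_right (1/2)))))"
    (is "?L \<longleftrightarrow> ?decay \<and> ?bdry \<and> ?moments")
proof -
  have pos: "0 < norm (Complex \<sigma> s)" if "1/2 < \<sigma>" for \<sigma> s
    using that by (simp add: complex_eq_iff)
  have powi: "x \<le> C * r powi (- int n) \<longleftrightarrow> x * r ^ n \<le> C" if "0 < r" for x C r :: real and n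
    using that by (simp add: power_int_minus field_simps)
  have lims: "has_boundary_limits g \<longleftrightarrow> ?bdry \<and> ?moments"
  proof -
    have "has_boundary_limits g \<longleftrightarrow> (\<forall>k. k = 0 \<or> k \<ge> 1 \<longrightarrow> (\<exists>h. L2_tendsto lborel (\<lambda>\<sigma> s. complex_of_real s ^ k * g (Complex \<sigma> s)) h (at_right (1/2))))"
      unfolding has_boundary_limits_def by (metis less_one not_le)
    also have "\<dots> \<longleftrightarrow> ?bdry \<and> ?moments"
      by (simp only: imp_disjL all_conj_distrib simp_thms power_0 mult_1)
    finally show ?thesis .
  qed
  have decay: "rapidly_decreasing g \<longleftrightarrow> ?decay"
  proof
    assume R: "rapidly_decreasing g"
    show ?decay
    proof (intro allI impI)
      fix n :: nat and a b :: real assume "0 < n" and ab: "1/2 < a \<and> a \<le> b"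
      obtain C where C: "\<And>s \<sigma>. \<sigma> \<in> {a..b} \<Longrightarrow> norm (g (Complex \<sigma> s)) * norm (Complex \<sigma> s) ^ n \<le> C"
        using R ab unfolding rapidly_decreasing_def by meson
      have "norm (g (Complex \<sigma> s)) \<le> C * norm (Complex \<sigma> s) powi (- int n)" if "\<sigma> \<in> {a..b}" for s \<sigma>
        using C[OF that, of s] powi[OF pos[of \<sigma> s]] that ab by auto
      then show "\<exists>C. \<forall>s. \<forall>\<sigma>\<in>{a..b}. norm (g (Complex \<sigma> s)) \<le> C * norm (Complex \<sigma> s) powi (- int n)" by blast
    qed
  next
    assume ?decay
    have dec: "\<exists>C. \<forall>s. \<forall>\<sigma>\<in>{a..b}. norm (g (Complex \<sigma> s)) * norm (Complex \<sigma> s) ^ n \<le> C"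
      if ab: "1/2 < a" "a \<le> b" and n: "0 < n" for n a b
    proof -
      obtain C where C: "\<And>s \<sigma>. \<sigma> \<in> {a..b} \<Longrightarrow> norm (g (Complex \<sigma> s)) \<le> C * norm (Complex \<sigma> s) powi (- int n)"
        using \<open>?decay\<close> ab n by meson
      have "norm (g (Complex \<sigma> s)) * norm (Complex \<sigma> s) ^ n \<le> C" if "\<sigma> \<in> {a..b}" for s \<sigma>
        using C[OF that, of s] powi[OF pos[of \<sigma> s]] that ab by auto
      then show ?thesis by blast
    qed
    have "\<exists>C. \<forall>s. \<forall>\<sigma>\<in>{a..b}. norm (g (Complex \<sigma> s)) * norm (Complex \<sigma> s) ^ n \<le> C"
      if ab: "1/2 < a" "a \<le> b" for n a b
    proof (cases "n = 0")
      case True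
      obtain C where C: "\<And>s \<sigma>. \<sigma> \<in> {a..b} \<Longrightarrow> norm (g (Complex \<sigma> s)) * norm (Complex \<sigma> s) ^ 1 \<le> C"
        using dec[OF ab zero_less_one] by blast
      have "norm (g (Complex \<sigma> s)) * norm (Complex \<sigma> s) ^ n \<le> 2 * C" if "\<sigma> \<in> {a..b}" for s \<sigma>
      proof -
        have "1/2 \<le> norm (Complex \<sigma> s)"
          using that ab complex_Re_le_cmod[of "Complex \<sigma> s"] by simp
        then have "norm (g (Complex \<sigma> s)) * (1/2) \<le> norm (g (Complex \<sigma> s)) * norm (Complex \<sigma> s)"
          by (rule mult_left_mono) simp
        then show ?thesis using C[OF that, of s] True by simp
      qed
      then show ?thesis by blast
    qed (use dec[OF ab] in simp)
    moreover have "g holomorphic_on {z. Re z > 1/2}"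
      using assms by (rule analytic_imp_holomorphic)
    ultimately show "rapidly_decreasing g" by (simp add: rapidly_decreasing_def)
  qed
  show ?thesis unfolding decay[symmetric] lims[symmetric]
  proof
    assume ?L
    then obtain f where f: "f \<in> smooth_vectors" and g: "\<And>\<sigma> s. 1/2 < \<sigma> \<Longrightarrow> g (Complex \<sigma> s) = Mellin f (Complex \<sigma> s)"
      by auto
    have "rapidly_decreasing g"
      unfolding rapidly_decreasing_def
    proof (intro conjI allI impI)
      show "g holomorphic_on {z. Re z > 1/2}" using assms by (rule analytic_imp_holomorphic)
      fix n and a b :: real assume ab: "1/2 < a" "a \<le> b"
      show "\<exists>C. \<forall>s. \<forall>\<sigma>\<in>{a..b}. norm (g (Complex \<sigma> s)) * norm (Complex \<sigma> s) ^ n \<le> C"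
        using Mellin_rapid_decay[OF f ab, of n] ab g by fastforce
    qed
    moreover have "has_boundary_limits g"
      unfolding has_boundary_limits_def
    proof
      fix k
      obtain h where h: "L2_tendsto lborel (\<lambda>\<sigma> s. complex_of_real s ^ k * Mellin f (Complex \<sigma> s)) h (at_right (1/2))"
        using Mellin_boundary_limit_power[OF f] by blast
      have "\<forall>\<^sub>F \<sigma> in at_right (1/2). (\<lambda>s. complex_of_real s ^ k * g (Complex \<sigma> s))
         = (\<lambda>s. complex_of_real s ^ k * Mellin f (Complex \<sigma> s))"
        using eventually_at_right_less[of "1/2 :: real"] by eventually_elim (simp add: g)
      from L2_tendsto_cong[OF this, THEN iffD2, OF h]
      show "\<exists>h. L2_tendsto lborel (\<lambda>\<sigma> s. complex_of_real s ^ k * g (Complex \<sigma> s)) h (at_right (1/2))"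
        by blast
    qed
    ultimately show "rapidly_decreasing g \<and> has_boundary_limits g" ..
  next
    assume "rapidly_decreasing g \<and> has_boundary_limits g"
    then have g: "rapidly_decreasing g" "has_boundary_limits g" by auto
    have "g z = Mellin (\<lambda>x. inverse_Mellin_exp g (ln x)) z" if "Re z > 1/2" for z
      using inverse_Mellin_smooth_vector(2)[OF g that, of "Im z"] by simp
    then show ?L using inverse_Mellin_smooth_vector(1)[OF g] by blast
  qed
qed

end
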